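(* Let $n\geq m\geq 1$ and $t\geq 1$ be integers, let $K$ be a field, $S=K[x_1,\ldots,x_n]$, and let $$I_{n,m}=(x_1x_2\cdots x_m,\;x_2x_3\cdots x_{m+1},\;\ldots,\;x_{n-m+1}\cdots x_n)\subset S$$ be the $m$-path ideal of the path graph of length $n$. Let $t_0=\min\{t,n-m\}$. Then $$\operatorname{sdepth}(I_{n,m}^t)\leq \min\left\{n-\left\lceil\frac{t_0}{2}\right\rceil,\; n-\left\lfloor\frac{n-t_0+1}{m+1}\right\rfloor+1\right\}.$$
   Context: Stanley depth: let $S=K[x_1,\ldots,x_n]$ be a polynomial ring over a field $K$ and $M$ a $\mathbb Z^n$-graded $S$-module. A Stanley decomposition of $M$ is a direct sum decomposition $\mathcal D: M=\bigoplus_{i=1}^r m_iK[Z_i]$ as a $\mathbb Z^n$-graded $K$-vector space, where each $m_i\in M$ is homogeneous with respect to the $\mathbb Z^n$-grading, $Z_i\subset\{x_1,\ldots,x_n\}$, and $m_iK[Z_i]=\{um_i: u\in K[Z_i]\}\subset M$ is a free $K[Z_i]$-submodule. Put $\operatorname{sdepth}(\mathcal D)=\min_i|Z_i|$ and $\operatorname{sdepth}(M)=\max\{\operatorname{sdepth}(\mathcal D):\mathcal D$ a Stanley decomposition of $M\}$. The power $I_{n,m}^t$ is the ordinary $t$-th power of the ideal. *)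

theory Defs
  imports
    Complex_Main
    "HOL-Library.Poly_Mapping"
    "HOL-Library.FuncSet"
    "HOL-Algebra.Ideal_Product"
    "HOL-Algebra.Module"
begin

text \<open>
  Polynomials over \<open>K\<close> in the variables \<open>x\<^sub>0, x\<^sub>1, \<dots>\<close> are finitely supported functions from
  exponent vectors to \<open>K\<close>; multiplication is the convolution product of
  \<^theory>\<open>HOL-Library.Poly_Mapping\<close>. The ring \<open>S = K[x\<^sub>1,\<dots>,x\<^sub>n]\<close> is the subring of those
  polynomials in which only the variables with index in \<open>{1..n}\<close> occur.
\<close>

type_synonym 'k mpoly = "(nat \<Rightarrow>\<^sub>0 nat) \<Rightarrow>\<^sub>0 'k"

definition var :: "nat \<Rightarrow> 'k::field mpoly" where
  "var i = Poly_Mapping.single (Poly_Mapping.single i 1) 1"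

definition polys_in :: "nat set \<Rightarrow> 'k::field mpoly set" where
  "polys_in Z = {p. \<forall>e\<in>Poly_Mapping.keys p. Poly_Mapping.keys e \<subseteq> Z}"

definition poly_ring :: "nat \<Rightarrow> 'k::field mpoly ring" where
  "poly_ring n = \<lparr> carrier = polys_in {1..n}, monoid.mult = (*), one = 1, zero = 0, add = (+) \<rparr>"

text \<open>
  Degrees in \<open>\<int>\<^sup>n\<close> are finitely supported functions \<open>nat \<Rightarrow>\<^sub>0 int\<close> with support in \<open>{1..n}\<close>.
  A grading of a module \<open>M\<close> is given by its family \<open>G\<close> of components, \<open>G a\<close> being the
  component \<open>M\<^sub>a\<close> of degree \<open>a\<close>.
\<close>

definition homogeneous :: "nat \<Rightarrow> ((nat \<Rightarrow>\<^sub>0 int) \<Rightarrow> 'm set) \<Rightarrow> 'm \<Rightarrow> bool" where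
  "homogeneous n G f \<longleftrightarrow> (\<exists>a. Poly_Mapping.keys a \<subseteq> {1..n} \<and> f \<in> G a)"

definition stanley_space ::
    "('k::field mpoly, 'm) module \<Rightarrow> 'm \<times> nat set \<Rightarrow> 'm set" where
  "stanley_space M = (\<lambda>(f, Z). (\<lambda>u. u \<odot>\<^bsub>M\<^esub> f) ` polys_in Z)"

text \<open>
  The decomposition \<open>M = m\<^sub>1K[Z\<^sub>1] \<oplus> \<dots> \<oplus> m\<^sub>rK[Z\<^sub>r]\<close> is the list of the pairs
  \<open>(m\<^sub>i, Z\<^sub>i)\<close>, a set of variables being represented by the set of their indices.
  Freeness of \<open>m\<^sub>iK[Z\<^sub>i]\<close> means that \<open>m\<^sub>i\<close> is a basis, i.e. that \<open>u \<mapsto> u m\<^sub>i\<close> is injective on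
  \<open>K[Z\<^sub>i]\<close>. The sum is direct if every element of \<open>M\<close> is a sum \<open>g\<^sub>1 + \<dots> + g\<^sub>r\<close> with
  \<open>g\<^sub>i \<in> m\<^sub>iK[Z\<^sub>i]\<close> in exactly one way; it is compatible with the grading because the \<open>m\<^sub>i\<close>
  are homogeneous.
\<close>

definition stanley_decomposition ::
    "nat \<Rightarrow> ('k::field mpoly, 'm) module \<Rightarrow> ((nat \<Rightarrow>\<^sub>0 int) \<Rightarrow> 'm set)
      \<Rightarrow> ('m \<times> nat set) list \<Rightarrow> bool" where
  "stanley_decomposition n M G D \<longleftrightarrow>
     (\<forall>(f, Z) \<in> set D. f \<in> carrier M \<and> homogeneous n G f \<and> Z \<subseteq> {1..n} \<and>
        inj_on (\<lambda>u. u \<odot>\<^bsub>M\<^esub> f) (polys_in Z)) \<and>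
     (\<forall>h \<in> carrier M. \<exists>!g. g \<in> (\<Pi>\<^sub>E i\<in>{..<length D}. stanley_space M (D ! i)) \<and>
        h = (\<Oplus>\<^bsub>M\<^esub> i\<in>{..<length D}. g i))"

definition sdepth_of :: "('m \<times> nat set) list \<Rightarrow> nat" where
  "sdepth_of D = Min ((\<lambda>(f, Z). card Z) ` set D)"

definition sdepth ::
    "nat \<Rightarrow> ('k::field mpoly, 'm) module \<Rightarrow> ((nat \<Rightarrow>\<^sub>0 int) \<Rightarrow> 'm set) \<Rightarrow> nat" where
  "sdepth n M G = Max {sdepth_of D | D. stanley_decomposition n M G D}"

text \<open>
  An ideal \<open>I\<close> of \<open>S\<close> as an \<open>S\<close>-module, graded by \<open>I\<^sub>a = I \<inter> S\<^sub>a\<close>. The ring fields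
  \<open>mult\<close> and \<open>one\<close> of the module record are irrelevant.
\<close>

definition ideal_module :: "'k::field mpoly set \<Rightarrow> ('k mpoly, 'k mpoly) module" where
  "ideal_module I =
     \<lparr> carrier = I, monoid.mult = (*), one = 1, zero = 0, add = (+), smult = (*) \<rparr>"

definition ideal_component :: "'k::field mpoly set \<Rightarrow> (nat \<Rightarrow>\<^sub>0 int) \<Rightarrow> 'k mpoly set" where
  "ideal_component I a =
     {f \<in> I. \<forall>e\<in>Poly_Mapping.keys f. \<forall>i. int (Poly_Mapping.lookup e i) = Poly_Mapping.lookup a i}"

definition sdepth_ideal :: "nat \<Rightarrow> 'k::field mpoly set \<Rightarrow> nat" where
  "sdepth_ideal n I = sdepth n (ideal_module I) (ideal_component I)"

definition path_ideal :: "nat \<Rightarrow> nat \<Rightarrow> 'k::field mpoly set" where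
  "path_ideal n m =
     Idl\<^bsub>poly_ring n\<^esub> {\<Prod>i\<in>{j..<j + m}. var i | j. 1 \<le> j \<and> j + m \<le> n + 1}"

definition ideal_power :: "nat \<Rightarrow> 'k::field mpoly set \<Rightarrow> nat \<Rightarrow> 'k mpoly set" where
  "ideal_power n I t = I [^]\<^bsub>ideals_set (poly_ring n)\<^esub> t"

lemma polys_in_mult:
  assumes "p \<in> polys_in Z" "q \<in> polys_in Z"
  shows "p * q \<in> polys_in Z"
proof -
  have "Poly_Mapping.keys e \<subseteq> Z" if e: "e \<in> Poly_Mapping.keys (p * q)" for e
  proof -
    obtain a b where "a \<in> Poly_Mapping.keys p" "b \<in> Poly_Mapping.keys q" "e = a + b"
      using e keys_mult[of p q] by auto
    then show ?thesis
      using assms keys_add[of a b] by (fastforce simp: polys_in_def)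
  qed
  then show ?thesis by (auto simp: polys_in_def)
qed

lemma cring_poly_ring: "cring (poly_ring n)"
proof (rule cringI)
  show "abelian_group (poly_ring n :: 'a mpoly ring)"
  proof (rule abelian_groupI)
    fix x :: "'a mpoly" assume "x \<in> carrier (poly_ring n)"
    then have "- x \<in> carrier (poly_ring n)"
      by (simp add: poly_ring_def polys_in_def)
    then show "\<exists>y\<in>carrier (poly_ring n). y \<oplus>\<^bsub>poly_ring n\<^esub> x = \<zero>\<^bsub>poly_ring n\<^esub>"
      by (intro bexI[of _ "- x"]) (auto simp: poly_ring_def)
  next
    fix x y :: "'a mpoly"
    assume "x \<in> carrier (poly_ring n)" "y \<in> carrier (poly_ring n)"
    then show "x \<oplus>\<^bsub>poly_ring n\<^esub> y \<in> carrier (poly_ring n)"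
      using keys_add[of x y] by (auto simp: poly_ring_def polys_in_def)
  qed (auto simp: poly_ring_def polys_in_def algebra_simps)
  show "comm_monoid (poly_ring n :: 'a mpoly ring)"
    by (rule comm_monoidI)
      (auto simp: poly_ring_def polys_in_mult algebra_simps, auto simp: polys_in_def)
qed (auto simp: poly_ring_def algebra_simps)

lemma module_ideal_module:
  assumes "ideal I (poly_ring n)"
  shows "module (poly_ring n) (ideal_module I)"
proof -
  interpret ideal I "poly_ring n" by fact
  have sub: "p + q \<in> I" if "p \<in> I" "q \<in> I" for p q
    using additive_subgroup.a_closed[OF additive_subgroup_axioms that] by (simp add: poly_ring_def)
  have zero: "0 \<in> I"
    using additive_subgroup.zero_closed[OF additive_subgroup_axioms] by (simp add: poly_ring_def)
  have smul: "p * q \<in> I" if "p \<in> polys_in {1..n}" "q \<in> I" for p q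
    using I_l_closed[of q p] that by (simp add: poly_ring_def)
  have one: "- 1 \<in> (polys_in {1..n} :: 'a mpoly set)"
    by (simp add: polys_in_def)
  show ?thesis
  proof (rule moduleI[OF cring_poly_ring])
    show "abelian_group (ideal_module I)"
    proof (rule abelian_groupI)
      fix x assume "x \<in> carrier (ideal_module I)"
      then have "- x \<in> carrier (ideal_module I)"
        using smul[OF one, of x] by (simp add: ideal_module_def)
      then show "\<exists>y\<in>carrier (ideal_module I). y \<oplus>\<^bsub>ideal_module I\<^esub> x = \<zero>\<^bsub>ideal_module I\<^esub>"
        by (intro bexI[of _ "- x"]) (auto simp: ideal_module_def)
    qed (auto simp: ideal_module_def sub zero algebra_simps)
  qed (auto simp: ideal_module_def poly_ring_def smul algebra_simps)
qed

end

theory Submission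
  imports Defs
begin

text \<open>
  A Stanley decomposition of a monomial ideal partitions its set \<open>U\<close> of exponents into blocks
  \<open>a + \<nat>\<^bsup>Z\<^esup>\<close>. Suppose that, for an exponent \<open>w\<close> and disjoint nonempty sets of variables
  \<open>P\<^sub>1, \<dots>, P\<^sub>r\<close> with \<open>N\<close> elements in all, the product of \<open>x\<^sup>w\<close> with squarefree monomials in
  these variables lies in the ideal if the monomial is a transversal of the \<open>P\<^sub>i\<close>, and does not
  lie in it if the monomial misses some \<open>P\<^sub>i\<close>. Counting the squarefree multiples of degree
  \<open>r + 1\<close> covered by the blocks of the transversals shows that the Stanley depth \<open>k\<close> satisfies
  \<open>2k + N \<le> 2n + r\<close>.

  The first bound comes from the \<open>m\<close> residue classes modulo \<open>m\<close> of \<open>{1..t\<^sub>0 + m}\<close>, the second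
  one from a single class of vertices in a vertex cover of the path.
\<close>

section \<open>Exponent vectors and blocks of exponents\<close>

type_synonym expo = "nat \<Rightarrow>\<^sub>0 nat"

abbreviation lookup where "lookup \<equiv> Poly_Mapping.lookup"
abbreviation keys where "keys \<equiv> Poly_Mapping.keys"

text \<open>The exponent vector of the squarefree monomial with support \<open>T\<close>. For
  infinite \<open>T\<close> the sum defaults to 0, whence the finiteness hypotheses in the lemmas
  below.\<close>

definition ind :: "nat set \<Rightarrow> expo" where
  "ind T = (\<Sum>i\<in>T. Poly_Mapping.single i 1)"

lemma lookup_ind: "finite T \<Longrightarrow> lookup (ind T) i = of_bool (i \<in> T)"
  by (simp add: ind_def lookup_sum lookup_single when_def of_bool_def sum.delta)

lemma keys_ind: "finite T \<Longrightarrow> keys (ind T) = T"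
  by (auto simp: in_keys_iff lookup_ind)

text \<open>The exponents of the monomials in the Stanley space \<open>x^a K[Z]\<close>. The
  coordinatewise form lets membership be checked one variable at a time.\<close>

definition block :: "expo \<Rightarrow> nat set \<Rightarrow> expo set" where
  "block a Z = {e. \<forall>i. lookup a i \<le> lookup e i \<and> (i \<notin> Z \<longrightarrow> lookup e i = lookup a i)}"

lemma block_decompose:
  assumes "e \<in> block a Z"
  obtains z where "e = a + z" "keys z \<subseteq> Z"
proof
  have z: "lookup (e - a) i = lookup e i - lookup a i" for i
    by (transfer) simp
  show "e = a + (e - a)"
    using assms by (intro poly_mapping_eqI) (simp add: block_def lookup_add z)
  show "keys (e - a) \<subseteq> Z"
    using assms by (auto simp: block_def in_keys_iff z)
qed

lemma add_in_block: "keys z \<subseteq> Z \<Longrightarrow> a + z \<in> block a Z"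
  by (auto simp: block_def lookup_add in_keys_iff subset_iff)

section \<open>A counting bound for partitions into blocks\<close>

text \<open>An involution maps \<open>A\<close> injectively, here onto a subset of \<open>B\<close>
  that is disjoint from \<open>A\<close>.\<close>

lemma twice_card_le:
  assumes "finite B" "A \<subseteq> B" and \<sigma>: "\<And>x. x \<in> B \<Longrightarrow> \<sigma> x \<in> B" "\<And>x. x \<in> B \<Longrightarrow> \<sigma> (\<sigma> x) = x"
    and "\<And>x. x \<in> A \<Longrightarrow> \<sigma> x \<notin> A"
  shows "2 * card A \<le> card B"
proof -
  have "inj_on \<sigma> A"
    by (rule inj_on_inverseI[where g = \<sigma>]) (use assms in auto)
  then have "2 * card A = card (A \<union> \<sigma> ` A)"
    using assms finite_subset[of A B] by (subst card_Un_disjoint) (auto simp: card_image)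
  also have "\<dots> \<le> card B"
    using assms by (intro card_mono) auto
  finally show ?thesis .
qed

lemma add_ind_in_block:
  assumes "finite S"
  shows "w + ind S \<in> block a Z \<longleftrightarrow>
    (\<forall>i. lookup a i \<le> lookup w i + of_bool (i \<in> S) \<and>
      (i \<notin> Z \<longrightarrow> lookup w i + of_bool (i \<in> S) = lookup a i))"
  by (simp add: block_def lookup_add lookup_ind[OF assms])

text \<open>Blocks are closed under coordinatewise minima, and the minimum of the two given points
  is the point belonging to \<open>S - {j, j'}\<close>.\<close>

lemma block_avoiding_point:
  assumes "finite S" "j \<in> S" "j' \<in> S" "j \<noteq> j'"
    and "w + ind (S - {j}) \<in> block a Z" "w + ind (S - {j'}) \<in> block a Z"
  shows "w + ind (S - {j, j'}) \<in> block a Z"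
proof -
  have j: "\<forall>i. lookup a i \<le> lookup w i + of_bool (i \<in> S - {j}) \<and>
      (i \<notin> Z \<longrightarrow> lookup w i + of_bool (i \<in> S - {j}) = lookup a i)"
    and j': "\<forall>i. lookup a i \<le> lookup w i + of_bool (i \<in> S - {j'}) \<and>
      (i \<notin> Z \<longrightarrow> lookup w i + of_bool (i \<in> S - {j'}) = lookup a i)"
    using assms(1,5,6) by (simp_all add: add_ind_in_block)
  have "lookup a i \<le> lookup w i + of_bool (i \<in> S - {j, j'}) \<and>
      (i \<notin> Z \<longrightarrow> lookup w i + of_bool (i \<in> S - {j, j'}) = lookup a i)" for i
    using j[rule_format, of i] j'[rule_format, of i] assms(2-4)
    by (cases "i = j"; cases "i = j'"; cases "i \<in> S") (auto split: if_splits)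
  then show ?thesis
    using assms(1) by (simp add: add_ind_in_block)
qed

lemma insert_in_block:
  assumes "finite S" "w + ind S \<in> block a Z" "j \<in> Z"
  shows "w + ind (insert j S) \<in> block a Z"
proof -
  have S: "\<forall>i. lookup a i \<le> lookup w i + of_bool (i \<in> S) \<and>
      (i \<notin> Z \<longrightarrow> lookup w i + of_bool (i \<in> S) = lookup a i)"
    using assms by (simp add: add_ind_in_block)
  have "lookup a i \<le> lookup w i + of_bool (i \<in> insert j S) \<and>
      (i \<notin> Z \<longrightarrow> lookup w i + of_bool (i \<in> insert j S) = lookup a i)" for i
    using S[rule_format, of i] assms(3) by (cases "i = j"; cases "i \<in> S") auto
  then show ?thesis
    using assms(1) by (simp add: add_ind_in_block)
qed

text \<open>
  A transversal \<open>T\<close> of the fibres of \<open>cl\<close> gives the point \<open>w + ind T\<close>. Each of the directions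
  \<open>j \<notin> T\<close> of its block leads to \<open>w + ind (insert j T)\<close>, and \<open>insert j T\<close> contains exactly two
  transversals. They cannot both reach this point inside their blocks: the two blocks would be
  the same and would contain the meet of the two transversals, which misses a fibre.
\<close>

lemma block_partition_bound:
  fixes a :: "'i \<Rightarrow> expo" and Z :: "'i \<Rightarrow> nat set" and cl :: "nat \<Rightarrow> 'c"
  assumes part: "\<And>e. e \<in> U \<Longrightarrow> \<exists>i\<in>I. e \<in> block (a i) (Z i)"
    and disj: "\<And>e i j. i \<in> I \<Longrightarrow> j \<in> I \<Longrightarrow> e \<in> block (a i) (Z i) \<Longrightarrow> e \<in> block (a j) (Z j) \<Longrightarrow> i = j"
    and sub: "\<And>i. i \<in> I \<Longrightarrow> block (a i) (Z i) \<subseteq> U"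
    and Z: "\<And>i. i \<in> I \<Longrightarrow> Z i \<subseteq> {1..n} \<and> k \<le> card (Z i)"
    and V: "V \<subseteq> {1..n}"
    and transversal: "\<And>T. T \<subseteq> V \<Longrightarrow> bij_betw cl T (cl ` V) \<Longrightarrow> w + ind T \<in> U"
    and missing: "\<And>E. E \<subseteq> V \<Longrightarrow> cl ` E \<noteq> cl ` V \<Longrightarrow> w + ind E \<notin> U"
  shows "2 * k + card V \<le> 2 * n + card (cl ` V)"
proof -
  define TT where "TT = {T. T \<subseteq> V \<and> bij_betw cl T (cl ` V)}"
  have finV: "finite V" using V finite_subset by blast
  have finTT: "finite TT" unfolding TT_def using finV by auto
  have finT: "finite T" if "T \<in> TT" for T
    using that finV finite_subset unfolding TT_def by blast
  \<comment> \<open>Some transversal exists, so the factor \<open>card TT\<close> is positive and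
    can be cancelled at the end.\<close>
  obtain T0 where "T0 \<subseteq> V" "inj_on cl T0" "cl ` T0 = cl ` V"
    using subset_image_inj[of "cl ` V" cl V] by auto
  then have "T0 \<in> TT" by (auto simp: TT_def bij_betw_def)
  then have posTT: "card TT > 0" using finTT card_gt_0_iff by blast
  have cardT: "card T = card (cl ` V)" if "T \<in> TT" for T
    using that bij_betw_same_card by (auto simp: TT_def)
  have "\<forall>T\<in>TT. \<exists>i\<in>I. w + ind T \<in> block (a i) (Z i)"
    using part transversal by (auto simp: TT_def)
  then obtain \<beta> where \<beta>: "\<And>T. T \<in> TT \<Longrightarrow> \<beta> T \<in> I \<and> w + ind T \<in> block (a (\<beta> T)) (Z (\<beta> T))"
    by metis
  \<comment> \<open>\<open>\<Omega>\<close> pairs a transversal with a further vertex;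
    \<open>\<Gamma>\<close> keeps the pairs whose vertex is a free direction of the transversal's
    block. \<open>\<sigma>\<close> puts \<open>j\<close> in place of \<open>r T j\<close>, the
    vertex of \<open>T\<close> in the same fibre, and records the displaced vertex.\<close>
  define \<Omega> where "\<Omega> = (SIGMA T:TT. V - T)"
  define \<Gamma> where "\<Gamma> = (SIGMA T:TT. V \<inter> Z (\<beta> T) - T)"
  define r where "r T j = the_inv_into T cl (cl j)" for T and j :: nat
  define \<sigma> where "\<sigma> = (\<lambda>(T, j). (insert j T - {r T j}, r T j))"
  have r: "r T j \<in> T" "cl (r T j) = cl j" "r T j \<noteq> j" if "(T, j) \<in> \<Omega>" for T j
  proof -
    have T: "inj_on cl T" "cl ` T = cl ` V" "T \<subseteq> V" "j \<in> V" "j \<notin> T"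
      using that by (auto simp: \<Omega>_def TT_def bij_betw_def)
    then have "cl j \<in> cl ` T" by blast
    then show "r T j \<in> T" "cl (r T j) = cl j"
      using T by (auto simp: r_def the_inv_into_into f_the_inv_into_f)
    with T show "r T j \<noteq> j" by auto
  qed
  have r_unique: "x = r T j" if "(T, j) \<in> \<Omega>" "x \<in> T" "cl x = cl j" for T j x
    using r[OF that(1)] that by (auto simp: \<Omega>_def TT_def bij_betw_def inj_on_def)
  have \<sigma>\<Omega>: "\<sigma> x \<in> \<Omega>" if x: "x \<in> \<Omega>" for x
  proof -
    obtain T j where [simp]: "x = (T, j)" by fastforce
    have T: "inj_on cl T" "cl ` T = cl ` V" "T \<subseteq> V" "j \<in> V" "j \<notin> T"
      using x by (auto simp: \<Omega>_def TT_def bij_betw_def)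
    have rr: "r T j \<in> T" "cl (r T j) = cl j" "r T j \<noteq> j" using r x by auto
    have "inj_on cl (insert j T - {r T j})"
      unfolding inj_on_def
    proof (intro ballI impI)
      fix x y assume xy: "x \<in> insert j T - {r T j}" "y \<in> insert j T - {r T j}" "cl x = cl y"
      show "x = y"
        using xy r_unique[of T j x] r_unique[of T j y] x T(1) by (auto simp: inj_on_def)
    qed
    moreover have "cl ` (insert j T - {r T j}) = cl ` V"
    proof
      show "cl ` (insert j T - {r T j}) \<subseteq> cl ` V" using T by auto
      show "cl ` V \<subseteq> cl ` (insert j T - {r T j})"
      proof
        fix c assume "c \<in> cl ` V"
        then obtain y where "y \<in> T" "c = cl y" using T(2) by auto
        then show "c \<in> cl ` (insert j T - {r T j})"
          using rr by (cases "y = r T j") auto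
      qed
    qed
    ultimately show ?thesis
      using T rr by (auto simp: \<sigma>_def \<Omega>_def TT_def bij_betw_def)
  qed
  have \<sigma>\<sigma>: "\<sigma> (\<sigma> x) = x" if x: "x \<in> \<Omega>" for x
  proof -
    obtain T j where [simp]: "x = (T, j)" by fastforce
    have rr: "r T j \<in> T" "cl (r T j) = cl j" "r T j \<noteq> j" using r x by auto
    have jT: "j \<notin> T" using x by (auto simp: \<Omega>_def)
    have s: "(insert j T - {r T j}, r T j) \<in> \<Omega>"
      using \<sigma>\<Omega>[OF x] by (simp add: \<sigma>_def)
    have "j = r (insert j T - {r T j}) (r T j)"
      using rr by (intro r_unique[OF s]) auto
    then show ?thesis
      using rr jT by (auto simp: \<sigma>_def)
  qed
  have "finite \<Omega>" using finTT finV by (auto simp: \<Omega>_def)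
  have good: "\<sigma> x \<notin> \<Gamma>" if x: "x \<in> \<Gamma>" for x
  proof
    assume sx: "\<sigma> x \<in> \<Gamma>"
    obtain T j where [simp]: "x = (T, j)" by fastforce
    have "x \<in> \<Omega>" using x by (auto simp: \<Omega>_def \<Gamma>_def)
    then have rr: "r T j \<in> T" "cl (r T j) = cl j" "r T j \<noteq> j" using r by auto
    define T' where "T' = insert j T - {r T j}"
    define S where "S = insert j T"
    have T: "T \<in> TT" "j \<in> V" "j \<notin> T" "j \<in> Z (\<beta> T)"
      using x by (auto simp: \<Gamma>_def)
    have T': "T' \<in> TT" "r T j \<in> Z (\<beta> T')"
      using sx by (auto simp: \<Gamma>_def \<sigma>_def T'_def)
    have up: "w + ind S \<in> block (a (\<beta> Q)) (Z (\<beta> Q))"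
      if "Q \<in> TT" "insert i Q = S" "i \<in> Z (\<beta> Q)" for Q i
      using insert_in_block[OF finT[OF that(1)] _ that(3)] \<beta>[OF that(1)] that(2) by simp
    have "insert (r T j) T' = S" using rr by (auto simp: T'_def S_def)
    then have up': "w + ind S \<in> block (a (\<beta> T')) (Z (\<beta> T'))"
      using up[OF T'(1) _ T'(2)] by simp
    have "w + ind S \<in> block (a (\<beta> T)) (Z (\<beta> T))"
      using up[OF T(1) _ T(4)] by (simp add: S_def)
    with up' have "\<beta> T' = \<beta> T"
      using disj \<beta> T(1) T'(1) by blast
    then have "w + ind T' \<in> block (a (\<beta> T)) (Z (\<beta> T))"
      using \<beta>[OF T'(1)] by simp
    \<comment> \<open>\<open>T\<close> and \<open>T'\<close> arise from \<open>S\<close> by deleting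
      one of its two vertices in the fibre of \<open>j\<close>; deleting both empties that
      fibre.\<close>
    moreover have "T' = S - {r T j}" "S - {j} = T" using T by (auto simp: S_def T'_def)
    ultimately have "w + ind (S - {j, r T j}) \<in> block (a (\<beta> T)) (Z (\<beta> T))"
      using \<beta>[OF T(1)] rr finT[OF T(1)]
      by (intro block_avoiding_point) (simp_all add: S_def)
    moreover have "S - {j, r T j} = T - {r T j}" using T by (auto simp: S_def)
    ultimately have "w + ind (T - {r T j}) \<in> U"
      using sub \<beta>[OF T(1)] by auto
    moreover have "cl j \<notin> cl ` (T - {r T j})"
      using r_unique[OF \<open>x \<in> \<Omega>\<close>[simplified]] by force
    then have "cl ` (T - {r T j}) \<noteq> cl ` V" using T by blast
    ultimately show False
      using missing[of "T - {r T j}"] T by (auto simp: TT_def)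
  qed
  have "2 * card \<Gamma> \<le> card \<Omega>"
    by (rule twice_card_le[where \<sigma> = \<sigma>])
      (use \<open>finite \<Omega>\<close> \<sigma>\<Omega> \<sigma>\<sigma> good in \<open>auto simp: \<Gamma>_def \<Omega>_def\<close>)
  have card_\<Omega>: "card \<Omega> = card TT * (card V - card (cl ` V))"
  proof -
    have "card (V - T) = card V - card (cl ` V)" if "T \<in> TT" for T
      using that cardT[OF that] finT[OF that] by (subst card_Diff_subset) (auto simp: TT_def)
    then show ?thesis unfolding \<Omega>_def using finTT finV by (subst card_SigmaI) auto
  qed
  have "card TT * (k + card V - n - card (cl ` V)) \<le> (\<Sum>T\<in>TT. card (V \<inter> Z (\<beta> T) - T))"
  proof -
    \<comment> \<open>Inside \<open>{1..n}\<close> the sets \<open>V\<close> and \<open>?Z\<close>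
      share at least \<open>card V + k - n\<close> vertices, and removing \<open>T\<close> costs at
      most one vertex for each fibre.\<close>
    have "k + card V - n - card (cl ` V) \<le> card (V \<inter> Z (\<beta> T) - T)" if T: "T \<in> TT" for T
    proof -
      let ?Z = "Z (\<beta> T)"
      have Z': "?Z \<subseteq> {1..n}" "k \<le> card ?Z" using Z \<beta>[OF T] by auto
      then have finZ: "finite ?Z" using finite_subset by blast
      have "card ?Z + card V = card (?Z \<union> V) + card (?Z \<inter> V)"
        using finZ finV by (rule card_Un_Int)
      moreover have "card (?Z \<union> V) \<le> card {1..n}"
        using Z' V by (intro card_mono) auto
      moreover have "card (?Z \<inter> V) - card T \<le> card (?Z \<inter> V - T)"
        using finT[OF T] by (rule diff_card_le_card_Diff)
      ultimately show ?thesis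
        using Z' cardT[OF T] by (simp add: Int_commute)
    qed
    then have "(\<Sum>T\<in>TT. k + card V - n - card (cl ` V)) \<le> (\<Sum>T\<in>TT. card (V \<inter> Z (\<beta> T) - T))"
      by (intro sum_mono) auto
    then show ?thesis by simp
  qed
  also have "\<dots> = card \<Gamma>"
    unfolding \<Gamma>_def using finTT finV by (subst card_SigmaI) auto
  finally have "2 * (card TT * (k + card V - n - card (cl ` V))) \<le> card TT * (card V - card (cl ` V))"
    using \<open>2 * card \<Gamma> \<le> card \<Omega>\<close> unfolding card_\<Omega> by linarith
  then have "card TT * (2 * (k + card V - n - card (cl ` V))) \<le> card TT * (card V - card (cl ` V))"
    by (simp only: mult.left_commute)
  then have "2 * (k + card V - n - card (cl ` V)) \<le> card V - card (cl ` V)"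
    using posTT by (simp only: mult_le_cancel1)
  \<comment> \<open>Needed when the truncated difference on the left is 0: then
    \<open>k + card V\<close> is at most \<open>n\<close> plus the number of fibres, which is at
    most \<open>card V\<close>.\<close>
  moreover have "card (cl ` V) \<le> card V" using finV by (rule card_image_le)
  moreover have "card V \<le> n" using card_mono[OF _ V] by simp
  ultimately show ?thesis by linarith
qed

section \<open>Spans of monomials\<close>

text \<open>The \<open>K\<close>-span of the monomials with exponents in \<open>U\<close>. For an
  \<open>upset\<close> it is a monomial ideal of \<open>S\<close>, so that operations on ideals
  become operations on sets of exponents.\<close>

definition supported :: "expo set \<Rightarrow> 'k::field mpoly set" where
  "supported U = {p. keys p \<subseteq> U}"

definition mons :: "nat \<Rightarrow> expo set" where
  "mons n = {e. keys e \<subseteq> {1..n}}"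

definition upset :: "nat \<Rightarrow> expo set \<Rightarrow> bool" where
  "upset n U \<longleftrightarrow> U \<subseteq> mons n \<and> (\<forall>e\<in>U. \<forall>z\<in>mons n. e + z \<in> U)"

lemma upsetD: "upset n U \<Longrightarrow> e \<in> U \<Longrightarrow> keys z \<subseteq> {1..n} \<Longrightarrow> e + z \<in> U"
  by (auto simp: upset_def mons_def)

lemma upset_sub: "upset n U \<Longrightarrow> U \<subseteq> mons n"
  by (simp add: upset_def)

lemma zero_mons: "0 \<in> mons n"
  by (simp add: mons_def)

lemma add_mons: "e \<in> mons n \<Longrightarrow> z \<in> mons n \<Longrightarrow> e + z \<in> mons n"
  using keys_add[of e z] by (auto simp: mons_def)

lemma lookup_mons: "e \<in> mons n \<Longrightarrow> i \<notin> {1..n} \<Longrightarrow> lookup e i = 0"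
  by (auto simp: mons_def in_keys_iff)

lemma carrier_poly_ring: "carrier (poly_ring n) = supported (mons n)"
  by (auto simp: poly_ring_def polys_in_def supported_def mons_def)

lemma zero_supported: "0 \<in> supported U"
  by (simp add: supported_def)

lemma add_supported: "p \<in> supported U \<Longrightarrow> q \<in> supported U \<Longrightarrow> p + q \<in> supported U"
  using keys_add[of p q] by (auto simp: supported_def)

lemma single_supported: "e \<in> U \<Longrightarrow> Poly_Mapping.single e c \<in> supported U"
  by (auto simp: supported_def)

lemma poly_eq_sum_single: "p = (\<Sum>e\<in>keys p. Poly_Mapping.single e (lookup p e))"
  by (intro poly_mapping_eqI)
    (auto simp: lookup_sum lookup_single when_def in_keys_iff sum.delta')

lemma supported_induct [consumes 1, case_names zero add single]:
  assumes "p \<in> supported U" "P 0" "\<And>p q. P p \<Longrightarrow> P q \<Longrightarrow> P (p + q)"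
    "\<And>e c. e \<in> U \<Longrightarrow> P (Poly_Mapping.single e c)"
  shows "P p"
proof -
  have "P (\<Sum>e\<in>A. Poly_Mapping.single e (lookup p e))" if "finite A" "A \<subseteq> keys p" for A
    using that by (induction A) (use assms in \<open>auto simp: supported_def\<close>)
  from this[of "keys p"] show ?thesis
    by (simp flip: poly_eq_sum_single)
qed

lemma mult_supported:
  assumes "p \<in> supported A" "q \<in> supported B" "\<And>a b. a \<in> A \<Longrightarrow> b \<in> B \<Longrightarrow> a + b \<in> C"
  shows "p * q \<in> supported C"
  using assms keys_mult[of p q] by (fastforce simp: supported_def)

text \<open>Multiplication by an element of \<open>S\<close> only adds exponents from
  \<open>mons n\<close>, and an \<open>upset\<close> is stable under this.\<close>

lemma ideal_supported:
  assumes "upset n U"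
  shows "ideal (supported U :: 'k::field mpoly set) (poly_ring n)"
proof -
  interpret cring "poly_ring n :: 'k mpoly ring" by (rule cring_poly_ring)
  have U: "U \<subseteq> mons n" "\<And>e z. e \<in> U \<Longrightarrow> z \<in> mons n \<Longrightarrow> e + z \<in> U"
    using assms by (auto simp: upset_def)
  have neg: "- p \<in> supported U" if "p \<in> supported U" for p :: "'k mpoly"
    using that by (simp add: supported_def)
  show ?thesis
  proof (rule idealI)
    show "ring (poly_ring n :: 'k mpoly ring)" by (rule ring_axioms)
    show "subgroup (supported U :: 'k mpoly set) (add_monoid (poly_ring n))"
    proof (rule add.subgroupI)
      show "(supported U :: 'k mpoly set) \<subseteq> carrier (poly_ring n)"
        using U by (auto simp: carrier_poly_ring supported_def)
      show "(supported U :: 'k mpoly set) \<noteq> {}" using zero_supported by auto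
      fix p q :: "'k mpoly" assume p: "p \<in> supported U" and q: "q \<in> supported U"
      have "\<ominus>\<^bsub>poly_ring n\<^esub> p = - p"
        using p neg[OF p] U by (intro minus_equality)
          (auto simp: poly_ring_def polys_in_def supported_def mons_def)
      then show "\<ominus>\<^bsub>poly_ring n\<^esub> p \<in> supported U" using neg[OF p] by simp
      show "p \<oplus>\<^bsub>poly_ring n\<^esub> q \<in> supported U"
        using add_supported[OF p q] by (simp add: poly_ring_def)
    qed
    fix p x :: "'k mpoly" assume p: "p \<in> supported U" and x: "x \<in> carrier (poly_ring n)"
    have "p * x \<in> supported U"
      by (rule mult_supported[OF p x[unfolded carrier_poly_ring]]) (use U in auto)
    then show "x \<otimes>\<^bsub>poly_ring n\<^esub> p \<in> supported U" "p \<otimes>\<^bsub>poly_ring n\<^esub> x \<in> supported U"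
      by (simp_all add: poly_ring_def mult.commute)
  qed
qed

text \<open>The multiples of the generators form an \<open>upset\<close>, so their span is an ideal
  containing the generators. Conversely each term \<open>c x^(g + z)\<close> is \<open>c x^z\<close>
  times a generator.\<close>

lemma genideal_monomials:
  assumes "G \<subseteq> mons n"
  shows "Idl\<^bsub>poly_ring n\<^esub> ((\<lambda>g. Poly_Mapping.single g (1::'k::field)) ` G) =
    supported {g + z | g z. g \<in> G \<and> z \<in> mons n}"
    (is "?I = supported ?U")
proof
  interpret cring "poly_ring n :: 'k mpoly ring" by (rule cring_poly_ring)
  have "upset n ?U"
    unfolding upset_def
  proof (intro conjI ballI subsetI)
    fix e assume "e \<in> ?U"
    then show "e \<in> mons n" using assms add_mons by blast
  next
    fix e y assume "e \<in> ?U" "y \<in> mons n"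
    then obtain g z where "e = g + z" "g \<in> G" "z \<in> mons n" by blast
    then show "e + y \<in> ?U"
      using add_mons[OF \<open>z \<in> mons n\<close> \<open>y \<in> mons n\<close>] by (auto simp: add.assoc)
  qed
  moreover have "(\<lambda>g. Poly_Mapping.single g (1::'k)) ` G \<subseteq> supported ?U"
  proof (intro image_subsetI single_supported)
    fix g assume "g \<in> G"
    then have "g + 0 \<in> ?U" using zero_mons by blast
    then show "g \<in> ?U" by simp
  qed
  ultimately show "?I \<subseteq> supported ?U"
    by (intro genideal_minimal ideal_supported)
  have sub: "(\<lambda>g. Poly_Mapping.single g (1::'k)) ` G \<subseteq> carrier (poly_ring n)"
    using assms by (auto simp: carrier_poly_ring intro!: single_supported)
  interpret I: ideal ?I "poly_ring n :: 'k mpoly ring"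
    by (rule genideal_ideal[OF sub])
  show "supported ?U \<subseteq> ?I"
  proof
    fix p :: "'k mpoly" assume "p \<in> supported ?U"
    then show "p \<in> ?I"
    proof (induction rule: supported_induct)
      case zero
      show ?case using I.zero_closed by (simp add: poly_ring_def)
    next
      case (add p q)
      then show ?case using I.a_closed[of p q] by (simp add: poly_ring_def)
    next
      case (single e c)
      then obtain g z where gz: "e = g + z" "g \<in> G" "z \<in> mons n" by auto
      have "Poly_Mapping.single g 1 \<in> ?I"
        using genideal_self[OF sub] gz by auto
      then have "Poly_Mapping.single z c * Poly_Mapping.single g 1 \<in> ?I"
        using I.I_l_closed[of "Poly_Mapping.single g 1" "Poly_Mapping.single z c"] gz
        by (simp add: poly_ring_def polys_in_def mons_def)
      then show ?case by (simp add: mult_single gz add.commute)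
    qed
  qed
qed

text \<open>\<open>ideal_prod\<close> is generated inductively by products and sums, and a term
  \<open>c x^(a + b)\<close> is the product of \<open>c x^a\<close> and \<open>x^b\<close>.\<close>

lemma ideal_prod_supported:
  assumes "upset n A" "upset n B"
  shows "ideal_prod (poly_ring n) (supported A) (supported B :: 'k::field mpoly set) =
    supported {a + b | a b. a \<in> A \<and> b \<in> B}" (is "?P = supported ?U")
proof
  show "?P \<subseteq> supported ?U"
  proof
    fix p assume "p \<in> ?P"
    then show "p \<in> supported ?U"
    proof induction
      case (prod i j)
      then have "i * j \<in> supported ?U" by (rule mult_supported) auto
      then show ?case by (simp add: poly_ring_def)
    next
      case (sum p q)
      then show ?case using add_supported[of p ?U q] by (simp add: poly_ring_def)
    qed
  qed
  have term_in: "Poly_Mapping.single (a + b) c \<in> ?P" if "a \<in> A" "b \<in> B" for a b and c :: 'k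
    using ideal_prod.prod[of "Poly_Mapping.single a c" "supported A"
        "Poly_Mapping.single b 1" "supported B" "poly_ring n"] that
    by (simp add: single_supported mult_single poly_ring_def)
  show "supported ?U \<subseteq> ?P"
  proof
    fix p :: "'k mpoly" assume "p \<in> supported ?U"
    then show "p \<in> ?P"
    proof (induction rule: supported_induct)
      case zero
      show ?case
        using ideal_prod.prod[of 0 "supported A" 0 "supported B" "poly_ring n :: 'k mpoly ring"]
        by (simp add: zero_supported poly_ring_def)
    next
      case (add p q)
      then show ?case using ideal_prod.sum[of p "poly_ring n"] by (simp add: poly_ring_def)
    next
      case (single e c)
      then show ?case using term_in by auto
    qed
  qed
qed

section \<open>Stanley decompositions and partitions into blocks\<close>

text \<open>Translates the \<open>finsum\<close> of the module record, in which decompositions are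
  stated, into the ordinary sum of polynomials.\<close>

lemma finsum_ideal_module:
  assumes "upset n U" "finite A" "\<And>i. i \<in> A \<Longrightarrow> g i \<in> supported U"
  shows "(\<Oplus>\<^bsub>ideal_module (supported U)\<^esub> i\<in>A. g i) = (\<Sum>i\<in>A. g i)"
proof -
  interpret module "poly_ring n" "ideal_module (supported U)"
    by (intro module_ideal_module ideal_supported assms)
  show ?thesis
    using assms(2,3)
  proof (induction A)
    case empty
    show ?case by (subst M.finsum_empty) (simp add: ideal_module_def)
  next
    case (insert x A)
    then have "g \<in> A \<rightarrow> carrier (ideal_module (supported U))"
      "g x \<in> carrier (ideal_module (supported U))"
      by (auto simp: ideal_module_def)
    with insert show ?case
      by (subst M.finsum_insert) (auto simp: ideal_module_def)
  qed
qed

text \<open>Multiplication by \<open>c x^a\<close> shifts exponents by \<open>a\<close>, and each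
  coefficient can be divided by \<open>c\<close>.\<close>

lemma stanley_space_single:
  assumes "c \<noteq> (0 :: 'k::field)"
  shows "stanley_space (ideal_module I) (Poly_Mapping.single a c, Z) = supported (block a Z)"
proof -
  have eq: "stanley_space (ideal_module I) (Poly_Mapping.single a c, Z) =
      (\<lambda>u. u * Poly_Mapping.single a c) ` supported {e. keys e \<subseteq> Z}"
    by (simp add: stanley_space_def ideal_module_def polys_in_def supported_def subset_eq)
  show ?thesis
    unfolding eq
  proof (intro equalityI subsetI)
    fix p assume "p \<in> (\<lambda>u. u * Poly_Mapping.single a c) ` supported {e. keys e \<subseteq> Z}"
    then obtain u where u: "u \<in> supported {e. keys e \<subseteq> Z}" "p = u * Poly_Mapping.single a c"
      by auto
    show "p \<in> supported (block a Z)"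
      unfolding u(2)
      by (rule mult_supported[OF u(1) single_supported[of a "{a}"]])
        (auto simp: add.commute[of _ a] add_in_block)
  next
    fix p :: "'k mpoly" assume "p \<in> supported (block a Z)"
    then show "p \<in> (\<lambda>u. u * Poly_Mapping.single a c) ` supported {e. keys e \<subseteq> Z}"
    proof (induction rule: supported_induct)
      case zero
      show ?case by (rule image_eqI[of _ _ 0]) (auto simp: zero_supported)
    next
      case (add p q)
      then obtain u v where "u \<in> supported {e. keys e \<subseteq> Z}" "v \<in> supported {e. keys e \<subseteq> Z}"
        "p = u * Poly_Mapping.single a c" "q = v * Poly_Mapping.single a c" by auto
      then show ?case
        by (intro image_eqI[of _ _ "u + v"]) (auto simp: add_supported distrib_right)
    next
      case (single e d)
      then obtain z where "e = a + z" "keys z \<subseteq> Z" using block_decompose by blast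
      then show ?case
        by (intro image_eqI[of _ _ "Poly_Mapping.single z (d / c)"])
          (auto simp: mult_single assms add.commute single_supported)
    qed
  qed
qed

text \<open>A degree fixes every coordinate of an exponent, so a nonzero homogeneous element has
  exactly one term.\<close>

lemma homogeneous_component_single:
  assumes "homogeneous n (ideal_component I) f" "f \<noteq> 0"
  obtains a c where "f = Poly_Mapping.single a c" "c \<noteq> 0"
proof -
  obtain b where b: "\<And>e i. e \<in> keys f \<Longrightarrow> int (lookup e i) = lookup b i"
    using assms(1) unfolding homogeneous_def ideal_component_def by blast
  have "keys f \<noteq> {}" using assms(2) by simp
  then obtain a where a: "a \<in> keys f" by blast
  have "e = a" if "e \<in> keys f" for e
  proof (rule poly_mapping_eqI)
    fix i
    have "int (lookup e i) = int (lookup a i)" using b[OF that, of i] b[OF a, of i] by simp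
    then show "lookup e i = lookup a i" by simp
  qed
  with a have "keys f = {a}" by blast
  then have "(\<Sum>e\<in>keys f. Poly_Mapping.single e (lookup f e)) = Poly_Mapping.single a (lookup f a)"
    by simp
  with poly_eq_sum_single[of f] have "f = Poly_Mapping.single a (lookup f a)"
    by (rule trans)
  then show ?thesis
    by (rule that) (use a in \<open>simp add: in_keys_iff\<close>)
qed

text \<open>The decomposition is tested on the monomials \<open>x^e\<close> with \<open>e\<close> in
  \<open>U\<close>. Existence of a representation puts \<open>e\<close> into some block; uniqueness
  excludes a second block containing it.\<close>

lemma stanley_decomposition_blocks:
  assumes U: "upset n U"
    and D: "stanley_decomposition n (ideal_module (supported U :: 'k::field mpoly set))
      (ideal_component (supported U)) D"
  obtains a where
    "\<And>i. i < length D \<Longrightarrow> a i \<in> U"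
    "\<And>i. i < length D \<Longrightarrow> snd (D ! i) \<subseteq> {1..n}"
    "\<And>e. e \<in> U \<Longrightarrow> \<exists>i\<in>{..<length D}. e \<in> block (a i) (snd (D ! i))"
    "\<And>e i j. i < length D \<Longrightarrow> j < length D \<Longrightarrow> e \<in> block (a i) (snd (D ! i)) \<Longrightarrow>
      e \<in> block (a j) (snd (D ! j)) \<Longrightarrow> i = j"
proof -
  define M where "M = ideal_module (supported U :: 'k mpoly set)"
  define Z where "Z i = snd (D ! i)" for i
  let ?N = "{..<length D}"
  have carrier_M: "carrier M = supported U" by (simp add: M_def ideal_module_def)
  have fin: "(\<Oplus>\<^bsub>M\<^esub> i\<in>?N. g i) = (\<Sum>i\<in>?N. g i)"
    if "\<And>i. i < length D \<Longrightarrow> g i \<in> supported U" for g :: "nat \<Rightarrow> 'k mpoly"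
    unfolding M_def by (rule finsum_ideal_module[OF U]) (use that in auto)
  have "\<exists>a c. fst (D ! i) = Poly_Mapping.single a c \<and> c \<noteq> 0 \<and> a \<in> U \<and> Z i \<subseteq> {1..n}"
    if i: "i < length D" for i
  proof -
    obtain f Y where fY: "D ! i = (f, Y)" by fastforce
    then have "(f, Y) \<in> set D" using i by (metis nth_mem)
    then have f: "f \<in> supported U" "homogeneous n (ideal_component (supported U)) f" "Y \<subseteq> {1..n}"
      "inj_on (\<lambda>u. u * f) (polys_in Y)"
      using D by (auto simp: stanley_decomposition_def ideal_module_def)
    \<comment> \<open>Freeness rules out a zero generator, since 0 and 1 in \<open>K[Y]\<close>
      would have the same image.\<close>
    have "f \<noteq> 0"
    proof
      assume "f = 0"
      moreover have "(0 :: 'k mpoly) \<in> polys_in Y" "(1 :: 'k mpoly) \<in> polys_in Y"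
        by (auto simp: polys_in_def)
      ultimately show False using inj_onD[OF f(4), of 0 1] by simp
    qed
    then obtain a c where "f = Poly_Mapping.single a c" "c \<noteq> 0"
      using homogeneous_component_single f(2) by blast
    with f(1,3) show ?thesis by (auto simp: fY Z_def supported_def)
  qed
  then obtain a c where ac: "\<And>i. i < length D \<Longrightarrow>
      fst (D ! i) = Poly_Mapping.single (a i) (c i) \<and> c i \<noteq> 0 \<and> a i \<in> U \<and> Z i \<subseteq> {1..n}"
    by metis
  have space: "stanley_space M (D ! i) = supported (block (a i) (Z i))" if "i < length D" for i
  proof -
    have "D ! i = (Poly_Mapping.single (a i) (c i), Z i)"
      using ac[OF that] by (simp add: Z_def prod_eq_iff)
    then show ?thesis
      using ac[OF that] stanley_space_single[of "c i"] by (simp add: M_def)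
  qed
  have block_U: "block (a i) (Z i) \<subseteq> U" if "i < length D" for i
  proof
    fix e assume "e \<in> block (a i) (Z i)"
    then obtain z where "e = a i + z" "keys z \<subseteq> Z i" using block_decompose by blast
    then show "e \<in> U" using ac[OF that] by (auto intro!: upsetD[OF U])
  qed
  have in_U: "g i \<in> supported U" if "i < length D" "g i \<in> supported (block (a i) (Z i))"
    for g :: "nat \<Rightarrow> 'k mpoly" and i
    using that block_U[OF that(1)] by (auto simp: supported_def)
  have ex1: "\<exists>!g. g \<in> (\<Pi>\<^sub>E i\<in>?N. stanley_space M (D ! i)) \<and> h = (\<Oplus>\<^bsub>M\<^esub> i\<in>?N. g i)"
    if "h \<in> supported U" for h
    using D that by (simp add: stanley_decomposition_def M_def[symmetric] carrier_M)
  show ?thesis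
  proof (rule that)
    show "a i \<in> U" "snd (D ! i) \<subseteq> {1..n}" if "i < length D" for i
      using ac[OF that] by (simp_all add: Z_def)
    show "\<exists>i\<in>?N. e \<in> block (a i) (snd (D ! i))" if e: "e \<in> U" for e
    proof -
      have "Poly_Mapping.single e (1::'k) \<in> supported U" using e by (rule single_supported)
      then obtain g where g: "g \<in> (\<Pi>\<^sub>E i\<in>?N. stanley_space M (D ! i))"
        "Poly_Mapping.single e (1::'k) = (\<Oplus>\<^bsub>M\<^esub> i\<in>?N. g i)"
        using ex1 by blast
      have gi: "g i \<in> supported (block (a i) (Z i))" if "i < length D" for i
        using g(1) space[OF that] that by (auto simp: PiE_def Pi_def)
      have "Poly_Mapping.single e (1::'k) = (\<Sum>i\<in>?N. g i)"
        unfolding g(2) by (rule fin) (use gi in_U in blast)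
      then have "e \<in> keys (\<Sum>i\<in>?N. g i)"
        by (rule subst[where P = "\<lambda>p. e \<in> keys p"]) simp
      then obtain i where "i < length D" "e \<in> keys (g i)"
        using keys_sum[of g ?N] by auto
      with gi show ?thesis by (auto simp: supported_def Z_def)
    qed
    show "i = j" if ij: "i < length D" "j < length D" "e \<in> block (a i) (snd (D ! i))"
      "e \<in> block (a j) (snd (D ! j))" for e i j
    proof (rule ccontr)
      assume "i \<noteq> j"
      let ?s = "Poly_Mapping.single e (1::'k)"
      \<comment> \<open>\<open>?g i\<close> and \<open>?g j\<close> place the whole monomial
        \<open>?s\<close> in component \<open>i\<close> or \<open>j\<close>. Both represent
        \<open>?s\<close>, so uniqueness makes them equal, which is absurd at index
        \<open>i\<close>.\<close>
      let ?g = "\<lambda>x. \<lambda>l\<in>?N. if l = x then ?s else 0"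
      have s: "?s \<in> supported U"
        using ij block_U by (intro single_supported) (auto simp: Z_def)
      have split: "?g x \<in> (\<Pi>\<^sub>E i\<in>?N. stanley_space M (D ! i)) \<and> ?s = (\<Oplus>\<^bsub>M\<^esub> i\<in>?N. ?g x i)"
        if x: "x < length D" "e \<in> block (a x) (snd (D ! x))" for x
      proof
        show "?g x \<in> (\<Pi>\<^sub>E i\<in>?N. stanley_space M (D ! i))"
          using x by (auto simp: space zero_supported Z_def intro!: single_supported)
        have "(\<Oplus>\<^bsub>M\<^esub> i\<in>?N. ?g x i) = (\<Sum>i\<in>?N. ?g x i)"
          using s by (intro fin) (auto simp: zero_supported)
        also have "\<dots> = ?s" using x by (simp add: sum.delta)
        finally show "?s = (\<Oplus>\<^bsub>M\<^esub> i\<in>?N. ?g x i)" ..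
      qed
      obtain g0 where uniq:
        "\<And>g. g \<in> (\<Pi>\<^sub>E i\<in>?N. stanley_space M (D ! i)) \<and> ?s = (\<Oplus>\<^bsub>M\<^esub> i\<in>?N. g i) \<Longrightarrow> g = g0"
        using ex1[OF s] by (elim ex1E) blast
      have "?g i = ?g j"
        using uniq[OF split[OF ij(1,3)]] uniq[OF split[OF ij(2,4)]] by (rule trans[OF _ sym])
      then have "?g i i = ?g j i" by (rule fun_cong)
      then have "?s = 0" using ij(1) \<open>i \<noteq> j\<close> by simp
      then have "lookup ?s e = 0" by simp
      then show False by simp
    qed
  qed
qed

section \<open>Existence of a Stanley decomposition\<close>

definition restr :: "expo set \<Rightarrow> 'k::field mpoly \<Rightarrow> 'k mpoly" where
  "restr B h = (\<Sum>e\<in>keys h \<inter> B. Poly_Mapping.single e (lookup h e))"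

lemma lookup_restr: "lookup (restr B h) e = (if e \<in> B then lookup h e else 0)"
  by (auto simp: restr_def lookup_sum lookup_single when_def sum.delta' in_keys_iff)

lemma restr_supported: "restr B h \<in> supported B"
  by (auto simp: supported_def in_keys_iff lookup_restr split: if_splits)

lemma finite_bounded_exponents: "finite {b \<in> mons n. \<forall>i. lookup b i \<le> t}"
proof (rule finite_imageD)
  let ?F = "{f. \<forall>x. (x \<in> {1..n} \<longrightarrow> f x \<in> {..t}) \<and> (x \<notin> {1..n} \<longrightarrow> f x = 0)}"
  have "finite ?F" by (rule finite_set_of_finite_funs) simp_all
  moreover have "lookup ` {b \<in> mons n. \<forall>i. lookup b i \<le> t} \<subseteq> ?F"
    using lookup_mons[of _ n] by (intro image_subsetI) simp
  ultimately show "finite (lookup ` {b \<in> mons n. \<forall>i. lookup b i \<le> t})"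
    by (rule rev_finite_subset)
  show "inj_on lookup {b \<in> mons n. \<forall>i. lookup b i \<le> t}"
    by (rule inj_onI) (simp only: poly_mapping_eq_iff)
qed

text \<open>
  If membership in \<open>U\<close> depends only on the exponents truncated at \<open>t\<close>, then the exponents with
  a common truncation \<open>b\<close> form a block whose free directions are those with \<open>b\<^sub>i = t\<close>.
  Existence matters because \<^const>\<open>sdepth\<close> is a \<^const>\<open>Max\<close>, which is unspecified on the empty set.
\<close>

lemma stanley_decomposition_exists:
  assumes U: "upset n U"
    and trunc: "\<And>e b. e \<in> U \<Longrightarrow> b \<in> mons n \<Longrightarrow>
      (\<And>i. min (lookup e i) t = min (lookup b i) t) \<Longrightarrow> b \<in> U"
  shows "\<exists>D. stanley_decomposition n (ideal_module (supported U :: 'k::field mpoly set))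
    (ideal_component (supported U)) D"
proof -
  define B where "B = {b \<in> U. \<forall>i. lookup b i \<le> t}"
  define Z where "Z b = {i \<in> {1..n}. lookup b i = t}" for b :: expo
  have "B \<subseteq> {b \<in> mons n. \<forall>i. lookup b i \<le> t}"
    using upset_sub[OF U] by (auto simp: B_def)
  then have "finite B" using finite_bounded_exponents finite_subset by blast
  then obtain bs where bs: "set bs = B" "distinct bs" using finite_distinct_list by blast
  let ?N = "{..<length bs}"
  define blk where "blk i = block (bs ! i) (Z (bs ! i))" for i
  define D where "D = map (\<lambda>b. (Poly_Mapping.single b (1::'k), Z b)) bs"
  define M where "M = ideal_module (supported U :: 'k mpoly set)"
  have bsB: "bs ! i \<in> B" if "i < length bs" for i using that bs by auto
  \<comment> \<open>A point of the block of \<open>b\<close> truncates to \<open>b\<close>, so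
    distinct elements of \<open>B\<close> have disjoint blocks.\<close>
  have blk_min: "lookup b i = min (lookup e i) t" if "b \<in> B" "e \<in> block b (Z b)" "e \<in> mons n" for b e i
    using that upset_sub[OF U]
    by (cases "i \<in> Z b"; cases "i \<in> {1..n}") (auto simp: B_def block_def Z_def)
  have blk_U: "blk i \<subseteq> U" if "i < length bs" for i
  proof
    fix e assume "e \<in> blk i"
    then obtain z where z: "e = bs ! i + z" "keys z \<subseteq> Z (bs ! i)"
      unfolding blk_def by (rule block_decompose)
    moreover have "Z (bs ! i) \<subseteq> {1..n}" by (auto simp: Z_def)
    moreover have "bs ! i \<in> U" using bsB[OF that] by (simp add: B_def)
    ultimately show "e \<in> U" using upsetD[OF U, of "bs ! i" z] by blast
  qed
  have cover: "\<exists>i. i < length bs \<and> e \<in> blk i" if e: "e \<in> U" for e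
  proof -
    \<comment> \<open>The truncation of \<open>e\<close> at \<open>t\<close>, which lies in
      \<open>U\<close> by \<open>trunc\<close>.\<close>
    define b where "b = Poly_Mapping.map (\<lambda>x. min x t) e"
    have lb: "lookup b i = min (lookup e i) t" for i
      by (simp add: b_def map.rep_eq when_def)
    have en: "e \<in> mons n" using upset_sub[OF U] e by blast
    then have bn: "b \<in> mons n" by (auto simp: mons_def in_keys_iff lb subset_iff)
    have "b \<in> U" by (rule trunc[OF e bn]) (simp add: lb)
    then have "b \<in> B" by (simp add: B_def lb)
    then obtain i where "i < length bs" "bs ! i = b" using bs by (metis in_set_conv_nth)
    moreover have "lookup e i \<le> t" if "i \<notin> Z b" for i
      using that lookup_mons[OF en] by (cases "i \<in> {1..n}") (auto simp: Z_def lb)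
    then have "e \<in> block b (Z b)" by (simp add: block_def lb)
    ultimately show ?thesis by (auto simp: blk_def)
  qed
  have uniq: "i = j" if "i < length bs" "j < length bs" "e \<in> blk i" "e \<in> blk j" for e i j
  proof -
    have "e \<in> mons n" using blk_U[OF that(1)] that(3) upset_sub[OF U] by blast
    then have "lookup (bs ! i) l = lookup (bs ! j) l" for l
      using that blk_min[OF bsB, of i e l] blk_min[OF bsB, of j e l] by (simp add: blk_def)
    then have "bs ! i = bs ! j" by (rule poly_mapping_eqI)
    then show ?thesis using bs that nth_eq_iff_index_eq by blast
  qed
  have [simp]: "length D = length bs" by (simp add: D_def)
  have space: "stanley_space M (D ! i) = supported (blk i)" if "i < length bs" for i
    using that by (simp add: D_def M_def stanley_space_single blk_def)
  have fin: "(\<Oplus>\<^bsub>M\<^esub> i\<in>?N. g i) = (\<Sum>i\<in>?N. g i)"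
    if "\<And>i. i < length bs \<Longrightarrow> g i \<in> supported (blk i)" for g :: "nat \<Rightarrow> 'k mpoly"
    unfolding M_def
  proof (rule finsum_ideal_module[OF U])
    fix i assume i: "i \<in> ?N"
    then have "g i \<in> supported (blk i)" using that by simp
    with blk_U[of i] i show "g i \<in> supported U" unfolding supported_def by blast
  qed simp
  \<comment> \<open>As the blocks are disjoint, only the \<open>i\<close>-th summand has
    coefficients at exponents of block \<open>i\<close>. This yields both existence and uniqueness
    of the components.\<close>
  have sum_lookup: "(\<Sum>j\<in>?N. lookup (g j) e) = lookup (g i) e"
    if g: "\<And>j. j < length bs \<Longrightarrow> g j \<in> supported (blk j)" and i: "i < length bs" "e \<in> blk i"
    for g :: "nat \<Rightarrow> 'k mpoly" and i e
  proof -
    have "lookup (g j) e = 0" if "j \<in> ?N - {i}" for j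
    proof -
      have "e \<notin> blk j" using uniq[of i j e] i that by auto
      then show ?thesis using g[of j] that by (auto simp: supported_def in_keys_iff)
    qed
    then have "(\<Sum>j\<in>?N. lookup (g j) e) = (\<Sum>j\<in>{i}. lookup (g j) e)"
      using i by (intro sum.mono_neutral_right) auto
    then show ?thesis by simp
  qed
  have decomp: "\<exists>!g. g \<in> (\<Pi>\<^sub>E i\<in>{..<length D}. stanley_space M (D ! i)) \<and>
      h = (\<Oplus>\<^bsub>M\<^esub> i\<in>{..<length D}. g i)" if h: "h \<in> supported U" for h :: "'k mpoly"
  proof (rule ex1I)
    \<comment> \<open>The component of \<open>h\<close> in block \<open>i\<close> consists of the
      terms of \<open>h\<close> with exponents there.\<close>
    let ?g = "\<lambda>i\<in>?N. restr (blk i) h"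
    have g: "?g i \<in> supported (blk i)" if "i < length bs" for i
      using that by (simp add: restr_supported)
    have "h = (\<Sum>i\<in>?N. ?g i)"
    proof (rule poly_mapping_eqI)
      fix e
      show "lookup h e = lookup (\<Sum>i\<in>?N. ?g i) e"
      proof (cases "e \<in> U")
        case True
        then obtain i where i: "i < length bs" "e \<in> blk i" using cover by blast
        then show ?thesis
          unfolding lookup_sum by (subst sum_lookup[OF g i]) (auto simp: lookup_restr)
      next
        case False
        then have "lookup h e = 0" using h by (auto simp: supported_def in_keys_iff)
        then show ?thesis by (simp add: lookup_sum lookup_restr cong: if_cong)
      qed
    qed
    then have "h = (\<Oplus>\<^bsub>M\<^esub> i\<in>?N. ?g i)" using fin[OF g] by (rule trans_sym)
    moreover have "?g \<in> (\<Pi>\<^sub>E i\<in>?N. stanley_space M (D ! i))"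
      using g by (simp add: space)
    ultimately show "?g \<in> (\<Pi>\<^sub>E i\<in>{..<length D}. stanley_space M (D ! i)) \<and>
        h = (\<Oplus>\<^bsub>M\<^esub> i\<in>{..<length D}. ?g i)" by simp
  next
    fix g assume "g \<in> (\<Pi>\<^sub>E i\<in>{..<length D}. stanley_space M (D ! i)) \<and>
      h = (\<Oplus>\<^bsub>M\<^esub> i\<in>{..<length D}. g i)"
    then have g: "g \<in> (\<Pi>\<^sub>E i\<in>?N. stanley_space M (D ! i))" "h = (\<Oplus>\<^bsub>M\<^esub> i\<in>?N. g i)"
      by simp_all
    have gi: "g i \<in> supported (blk i)" if "i < length bs" for i
      using PiE_mem[OF g(1), of i] space[OF that] that by simp
    have h_sum: "h = (\<Sum>i\<in>?N. g i)" using g(2) fin[OF gi] by (rule trans)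
    show "g = (\<lambda>i\<in>?N. restr (blk i) h)"
    proof (rule extensionalityI)
      show "g \<in> extensional ?N" using g(1) by (simp add: PiE_def)
      fix i assume "i \<in> ?N"
      then have i: "i < length bs" by simp
      have "lookup (g i) e = lookup (restr (blk i) h) e" for e
      proof (cases "e \<in> blk i")
        case True
        have "lookup h e = (\<Sum>j\<in>?N. lookup (g j) e)"
          unfolding h_sum by (rule lookup_sum)
        also have "\<dots> = lookup (g i) e" by (rule sum_lookup[OF gi i True])
        finally show ?thesis using True by (simp add: lookup_restr)
      next
        case False
        then show ?thesis using gi[OF i] by (auto simp: supported_def lookup_restr in_keys_iff)
      qed
      then have "g i = restr (blk i) h" by (rule poly_mapping_eqI)
      then show "g i = (\<lambda>i\<in>?N. restr (blk i) h) i"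
        using i by simp
    qed simp
  qed
  have gens: "f \<in> carrier M \<and> homogeneous n (ideal_component (supported U)) f \<and> Y \<subseteq> {1..n} \<and>
      inj_on (\<lambda>u. u \<odot>\<^bsub>M\<^esub> f) (polys_in Y)" if fY: "(f, Y) \<in> set D" for f Y
  proof -
    obtain b where b: "b \<in> B" "f = Poly_Mapping.single b 1" "Y = Z b"
      using fY bs by (auto simp: D_def)
    have bU: "b \<in> U" "b \<in> mons n" using b upset_sub[OF U] by (auto simp: B_def)
    \<comment> \<open>The degree of the generator is its exponent read as an integer vector.\<close>
    define c where "c = Poly_Mapping.map int b"
    have c: "lookup c i = int (lookup b i)" for i
      by (simp add: c_def map.rep_eq when_def)
    have "f \<in> ideal_component (supported U) c"
      using bU by (auto simp: ideal_component_def b c single_supported)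
    moreover have "keys c \<subseteq> {1..n}" using bU by (auto simp: mons_def in_keys_iff c subset_iff)
    moreover have "f \<noteq> 0"
      unfolding b(2) by (metis insert_not_empty keys_single keys_zero zero_neq_one)
    then have "inj_on (\<lambda>u. u * f) (polys_in Y)" by (intro inj_onI) simp
    ultimately show ?thesis
      using bU by (auto simp: homogeneous_def M_def ideal_module_def b Z_def single_supported)
  qed
  have "stanley_decomposition n M (ideal_component (supported U)) D"
    unfolding stanley_decomposition_def
  proof (intro conjI ballI)
    fix x assume "x \<in> set D"
    then show "case x of (f, Y) \<Rightarrow> f \<in> carrier M \<and> homogeneous n (ideal_component (supported U)) f \<and>
        Y \<subseteq> {1..n} \<and> inj_on (\<lambda>u. u \<odot>\<^bsub>M\<^esub> f) (polys_in Y)"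
      using gens by (intro case_prodI2) simp_all
  next
    fix h assume "h \<in> carrier M"
    then show "\<exists>!g. g \<in> (\<Pi>\<^sub>E i\<in>{..<length D}. stanley_space M (D ! i)) \<and>
        h = (\<Oplus>\<^bsub>M\<^esub> i\<in>{..<length D}. g i)"
      by (intro decomp) (simp add: M_def ideal_module_def)
  qed
  then show ?thesis unfolding M_def by blast
qed

text \<open>Each decomposition satisfies the counting bound with \<open>k\<close> its depth. Hence
  the set of depths is finite; it is nonempty thanks to \<open>trunc\<close>, so its maximum is
  attained and inherits the bound.\<close>

lemma sdepth_ideal_bound:
  fixes cl :: "nat \<Rightarrow> 'c"
  assumes U: "upset n U"
    and trunc: "\<And>e b. e \<in> U \<Longrightarrow> b \<in> mons n \<Longrightarrow>
      (\<And>i. min (lookup e i) t = min (lookup b i) t) \<Longrightarrow> b \<in> U"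
    and V: "V \<subseteq> {1..n}"
    and transversal: "\<And>T. T \<subseteq> V \<Longrightarrow> bij_betw cl T (cl ` V) \<Longrightarrow> w + ind T \<in> U"
    and missing: "\<And>E. E \<subseteq> V \<Longrightarrow> cl ` E \<noteq> cl ` V \<Longrightarrow> w + ind E \<notin> U"
  shows "2 * sdepth_ideal n (supported U :: 'k::field mpoly set) + card V \<le> 2 * n + card (cl ` V)"
proof -
  let ?SD = "{sdepth_of D | D. stanley_decomposition n (ideal_module (supported U :: 'k mpoly set))
    (ideal_component (supported U)) D}"
  have bound: "2 * k + card V \<le> 2 * n + card (cl ` V)" if k_in: "k \<in> ?SD" for k
  proof -
    obtain D where k: "k = sdepth_of D" and D: "stanley_decomposition n
        (ideal_module (supported U :: 'k mpoly set)) (ideal_component (supported U)) D"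
      using k_in by blast
    obtain a where a: "\<And>i. i < length D \<Longrightarrow> a i \<in> U"
      "\<And>i. i < length D \<Longrightarrow> snd (D ! i) \<subseteq> {1..n}"
      "\<And>e. e \<in> U \<Longrightarrow> \<exists>i\<in>{..<length D}. e \<in> block (a i) (snd (D ! i))"
      "\<And>e i j. i < length D \<Longrightarrow> j < length D \<Longrightarrow> e \<in> block (a i) (snd (D ! i)) \<Longrightarrow>
        e \<in> block (a j) (snd (D ! j)) \<Longrightarrow> i = j"
      by (rule stanley_decomposition_blocks[OF U D]) (rule that)
    show ?thesis
    proof (rule block_partition_bound[where I = "{..<length D}" and a = a and Z = "\<lambda>i. snd (D ! i)"])
      show "\<And>e. e \<in> U \<Longrightarrow> \<exists>i\<in>{..<length D}. e \<in> block (a i) (snd (D ! i))"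
        by (rule a(3))
      show "\<And>e i j. i \<in> {..<length D} \<Longrightarrow> j \<in> {..<length D} \<Longrightarrow>
        e \<in> block (a i) (snd (D ! i)) \<Longrightarrow> e \<in> block (a j) (snd (D ! j)) \<Longrightarrow> i = j"
        using a(4) by simp
      show "block (a i) (snd (D ! i)) \<subseteq> U" if i: "i \<in> {..<length D}" for i
      proof
        fix e assume "e \<in> block (a i) (snd (D ! i))"
        then obtain z where z: "e = a i + z" "keys z \<subseteq> snd (D ! i)" by (rule block_decompose)
        then show "e \<in> U" using upsetD[OF U a(1), of i z] a(2)[of i] i by auto
      qed
      show "snd (D ! i) \<subseteq> {1..n} \<and> k \<le> card (snd (D ! i))" if i: "i \<in> {..<length D}" for i
      proof
        show "snd (D ! i) \<subseteq> {1..n}" using a(2) i by simp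
        have "card (snd (D ! i)) \<in> (\<lambda>(f, Z). card Z) ` set D"
          using i by (intro image_eqI[of _ _ "D ! i"]) (auto split: prod.split)
        then show "k \<le> card (snd (D ! i))"
          unfolding k sdepth_of_def by (intro Min_le) auto
      qed
    qed (fact V transversal missing)+
  qed
  have "?SD \<subseteq> {..2 * n + card (cl ` V)}"
  proof
    fix k assume "k \<in> ?SD"
    then show "k \<in> {..2 * n + card (cl ` V)}" using bound[of k] by simp
  qed
  then have "finite ?SD" using finite_subset by blast
  moreover have "\<exists>D. stanley_decomposition n (ideal_module (supported U :: 'k mpoly set))
      (ideal_component (supported U)) D"
    by (rule stanley_decomposition_exists[OF U trunc])
  then have "?SD \<noteq> {}" by blast
  ultimately have "Max ?SD \<in> ?SD" by (rule Max_in)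
  then show ?thesis
    unfolding sdepth_ideal_def sdepth_def by (rule bound)
qed

section \<open>Powers of the path ideal\<close>

text \<open>The exponents of the multiples of products of \<open>t\<close> path generators:
  \<open>s p\<close> is the first vertex of the \<open>p\<close>-th window, and the sum counts the
  windows that contain \<open>i\<close>.\<close>

definition path_exps :: "nat \<Rightarrow> nat \<Rightarrow> nat \<Rightarrow> expo set" where
  "path_exps n m t = {e \<in> mons n. \<exists>s. (\<forall>p<t. 1 \<le> s p \<and> s p + m \<le> n + 1) \<and>
    (\<forall>i. (\<Sum>p<t. of_bool (i \<in> {s p..<s p + m})) \<le> lookup e i)}"

lemma path_expsI:
  assumes "e \<in> mons n" "\<And>p. p < t \<Longrightarrow> 1 \<le> s p \<and> s p + m \<le> n + 1"
    "\<And>i. (\<Sum>p<t. of_bool (i \<in> {s p..<s p + m})) \<le> lookup e i"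
  shows "e \<in> path_exps n m t"
  using assms unfolding path_exps_def by blast

lemma path_expsE:
  assumes "e \<in> path_exps n m t"
  obtains s where "e \<in> mons n" "\<And>p. p < t \<Longrightarrow> 1 \<le> s p \<and> s p + m \<le> n + 1"
    "\<And>i. (\<Sum>p<t. of_bool (i \<in> {s p..<s p + m})) \<le> lookup e i"
  using assms unfolding path_exps_def by blast

lemma path_exps_0: "path_exps n m 0 = mons n"
  by (auto simp: path_exps_def)

lemma upset_path_exps: "upset n (path_exps n m t)"
  unfolding upset_def
proof (intro conjI ballI)
  show "path_exps n m t \<subseteq> mons n" by (auto simp: path_exps_def)
  fix e z assume z: "z \<in> mons n" and "e \<in> path_exps n m t"
  from this(2) obtain s where s: "e \<in> mons n" "\<And>p. p < t \<Longrightarrow> 1 \<le> s p \<and> s p + m \<le> n + 1"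
    "\<And>i. (\<Sum>p<t. of_bool (i \<in> {s p..<s p + m})) \<le> lookup e i"
    by (rule path_expsE) (rule that)
  show "e + z \<in> path_exps n m t"
    by (rule path_expsI[where s = s])
      (use s z add_mons in \<open>auto simp: lookup_add intro: trans_le_add1\<close>)
qed

text \<open>At most \<open>t\<close> windows contain a given vertex, so larger exponents impose no
  further condition. This supplies the hypothesis \<open>trunc\<close> of
  \<open>sdepth_ideal_bound\<close>.\<close>

lemma path_exps_truncate:
  assumes "e \<in> path_exps n m t" "b \<in> mons n"
    "\<And>i. min (lookup e i) t = min (lookup b i) t"
  shows "b \<in> path_exps n m t"
proof -
  obtain s where "e \<in> mons n" and s: "\<And>p. p < t \<Longrightarrow> 1 \<le> s p \<and> s p + m \<le> n + 1"
    "\<And>i. (\<Sum>p<t. of_bool (i \<in> {s p..<s p + m})) \<le> lookup e i"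
    using assms(1) by (rule path_expsE) (rule that)
  show ?thesis
  proof (rule path_expsI[OF assms(2) s(1)])
    fix i
    have "(\<Sum>p<t. of_bool (i \<in> {s p..<s p + m})) \<le> (\<Sum>p<t. 1::nat)"
      by (intro sum_mono) simp
    then have "(\<Sum>p<t. of_bool (i \<in> {s p..<s p + m})) \<le> min (lookup e i) t"
      using s(2)[of i] by simp
    also have "\<dots> \<le> lookup b i" using assms(3)[of i] by simp
    finally show "(\<Sum>p<t. of_bool (i \<in> {s p..<s p + m})) \<le> lookup b i" .
  qed
qed

lemma ind_mons: "T \<subseteq> {1..n} \<Longrightarrow> ind T \<in> mons n"
  using keys_ind[of T] finite_subset[of T "{1..n}"] by (simp add: mons_def)

lemma path_exps_1:
  "path_exps n m 1 = {g + z | g z. g \<in> {ind {j..<j + m} | j. 1 \<le> j \<and> j + m \<le> n + 1} \<and> z \<in> mons n}"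
  (is "_ = ?R")
proof (intro equalityI subsetI)
  fix e assume "e \<in> path_exps n m 1"
  then obtain s :: "nat \<Rightarrow> nat" where s: "e \<in> mons n" "\<And>p. p < 1 \<Longrightarrow> 1 \<le> s p \<and> s p + m \<le> n + 1"
    "\<And>i. (\<Sum>p<1. of_bool (i \<in> {s p..<s p + m})) \<le> lookup e i"
    by (rule path_expsE) (rule that)
  define j where "j = s (0::nat)"
  have le: "of_bool (i \<in> {j..<j + m}) \<le> lookup e i" for i using s(3)[of i] by (simp add: j_def)
  have "e \<in> block (ind {j..<j + m}) {1..n}"
    unfolding block_def
  proof (intro CollectI allI conjI impI)
    fix i
    show "lookup (ind {j..<j + m}) i \<le> lookup e i" using le by (simp add: lookup_ind)
    moreover assume "i \<notin> {1..n}"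
    ultimately show "lookup e i = lookup (ind {j..<j + m}) i"
      using lookup_mons[OF s(1)] by simp
  qed
  then obtain z where "e = ind {j..<j + m} + z" "keys z \<subseteq> {1..n}" by (rule block_decompose)
  moreover have "1 \<le> j \<and> j + m \<le> n + 1" using s(2)[of 0] by (simp add: j_def)
  ultimately show "e \<in> ?R" unfolding mons_def by blast
next
  fix e assume "e \<in> ?R"
  then obtain j z where j: "e = ind {j..<j + m} + z" "1 \<le> j" "j + m \<le> n + 1" "z \<in> mons n"
    by blast
  then have "{j..<j + m} \<subseteq> {1..n}" by auto
  then have "e \<in> mons n" unfolding j(1) by (intro add_mons ind_mons j(4))
  then show "e \<in> path_exps n m 1"
    by (rule path_expsI[where s = "\<lambda>_. j"]) (use j in \<open>auto simp: lookup_add lookup_ind\<close>)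
qed

text \<open>The last window is split off as a factor of its own; conversely the window of
  \<open>a\<close> is appended at position \<open>t\<close>.\<close>

lemma path_exps_Suc:
  "path_exps n m (Suc t) = {a + b | a b. a \<in> path_exps n m 1 \<and> b \<in> path_exps n m t}" (is "_ = ?R")
proof (intro equalityI subsetI)
  fix e assume "e \<in> path_exps n m (Suc t)"
  then obtain s where s: "e \<in> mons n" "\<And>p. p < Suc t \<Longrightarrow> 1 \<le> s p \<and> s p + m \<le> n + 1"
    "\<And>i. (\<Sum>p<Suc t. of_bool (i \<in> {s p..<s p + m})) \<le> lookup e i"
    by (rule path_expsE) (rule that)
  define a where "a = ind {s t..<s t + m}"
  have le: "(\<Sum>p<t. of_bool (i \<in> {s p..<s p + m})) + lookup a i \<le> lookup e i" for i
    using s(3)[of i] by (simp add: a_def lookup_ind)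
  have win: "{s t..<s t + m} \<subseteq> {1..n}" using s(2)[of t] by auto
  \<comment> \<open>With all directions free, membership in the block of \<open>a\<close> means
    divisibility by \<open>x^a\<close>; the quotient gives \<open>b\<close>.\<close>
  have "e \<in> block a {1..n}"
    unfolding block_def
  proof (intro CollectI allI conjI impI)
    fix i
    show "lookup a i \<le> lookup e i" using le[of i] by simp
    moreover assume "i \<notin> {1..n}"
    ultimately show "lookup e i = lookup a i"
      using lookup_mons[OF s(1)] by simp
  qed
  then obtain b where b: "e = a + b" "keys b \<subseteq> {1..n}" by (rule block_decompose)
  have "a \<in> path_exps n m 1"
    by (rule path_expsI[where s = "\<lambda>_. s t"])
      (use s(2)[of t] ind_mons[OF win] in \<open>auto simp: lookup_ind a_def\<close>)
  moreover have "b \<in> path_exps n m t"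
    by (rule path_expsI[where s = s])
      (use le b s(2) in \<open>auto simp: mons_def lookup_add\<close>)
  ultimately show "e \<in> ?R" using b(1) by blast
next
  fix e assume "e \<in> ?R"
  then obtain a b where e: "e = a + b" "a \<in> path_exps n m 1" "b \<in> path_exps n m t" by blast
  obtain s :: "nat \<Rightarrow> nat" where s: "a \<in> mons n" "\<And>p. p < 1 \<Longrightarrow> 1 \<le> s p \<and> s p + m \<le> n + 1"
    "\<And>i. (\<Sum>p<1. of_bool (i \<in> {s p..<s p + m})) \<le> lookup a i"
    using e(2) by (rule path_expsE) (rule that)
  obtain s' where s': "b \<in> mons n" "\<And>p. p < t \<Longrightarrow> 1 \<le> s' p \<and> s' p + m \<le> n + 1"
    "\<And>i. (\<Sum>p<t. of_bool (i \<in> {s' p..<s' p + m})) \<le> lookup b i"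
    using e(3) by (rule path_expsE) (rule that)
  show "e \<in> path_exps n m (Suc t)"
  proof (rule path_expsI[where s = "s'(t := s 0)"])
    show "e \<in> mons n" using e(1) s s' add_mons by simp
    show "1 \<le> (s'(t := s 0)) p \<and> (s'(t := s 0)) p + m \<le> n + 1" if "p < Suc t" for p
      using that s(2)[of 0] s'(2)[of p] by auto
    show "(\<Sum>p<Suc t. of_bool (i \<in> {(s'(t := s 0)) p..<(s'(t := s 0)) p + m})) \<le> lookup e i" for i
      using s(3)[of i] s'(3)[of i] by (simp add: e(1) lookup_add)
  qed
qed

lemma prod_var: "finite A \<Longrightarrow> (\<Prod>i\<in>A. var i) = Poly_Mapping.single (ind A) (1::'k::field)"
  by (induction A rule: finite_induct) (simp_all add: ind_def var_def mult_single)

lemma path_ideal_supported: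
  "path_ideal n m = (supported (path_exps n m 1) :: 'k::field mpoly set)"
proof -
  let ?G = "{ind {j..<j + m} | j. 1 \<le> j \<and> j + m \<le> n + 1}"
  have "{\<Prod>i\<in>{j..<j + m}. var i | j. 1 \<le> j \<and> j + m \<le> n + 1} =
      (\<lambda>g. Poly_Mapping.single g (1::'k)) ` ?G"
    by (auto simp: prod_var)
  moreover have "?G \<subseteq> mons n"
    by (auto intro!: ind_mons)
  ultimately show ?thesis
    unfolding path_ideal_def path_exps_1 by (simp only: genideal_monomials)
qed

lemma ideal_power_supported:
  "ideal_power n (path_ideal n m) t = (supported (path_exps n m t) :: 'k::field mpoly set)"
proof (induction t)
  case 0
  show ?case
    by (simp add: ideal_power_def nat_pow_def ideals_set_def carrier_poly_ring path_exps_0)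
next
  case (Suc t)
  have "ideal_power n (path_ideal n m) (Suc t) =
      ideal_prod (poly_ring n) (ideal_power n (path_ideal n m) t) (path_ideal n m :: 'k mpoly set)"
    by (simp add: ideal_power_def nat_pow_def ideals_set_def)
  also have "\<dots> = supported {b + a | b a. b \<in> path_exps n m t \<and> a \<in> path_exps n m 1}"
    unfolding Suc.IH unfolding path_ideal_supported
    by (intro ideal_prod_supported upset_path_exps)
  \<comment> \<open>The power multiplies by the ideal on the right, whereas
    \<open>path_exps_Suc\<close> has the single generator on the left.\<close>
  also have "{b + a | b a. b \<in> path_exps n m t \<and> a \<in> path_exps n m 1} = path_exps n m (Suc t)"
    unfolding path_exps_Suc by (auto simp: add.commute) (metis add.commute)+
  finally show ?case .
qed

text \<open>A monomial of the \<open>t\<close>-th power has total exponent at least \<open>t\<close> on every vertex cover.\<close>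

lemma not_in_path_exps:
  assumes C: "finite C" "\<And>j. 1 \<le> j \<Longrightarrow> j + m \<le> n + 1 \<Longrightarrow> C \<inter> {j..<j + m} \<noteq> {}"
    and r: "r < t" "\<And>q. q < r \<Longrightarrow> card (C \<inter> {s q..<s q + m}) \<le> 1"
    and z: "\<And>i. i \<in> C \<Longrightarrow> lookup z i = 0"
  shows "(\<Sum>q<r. ind {s q..<s q + m}) + z \<notin> path_exps n m t"
proof
  have weight: "(\<Sum>i\<in>C. of_bool (i \<in> A) :: nat) = card (C \<inter> A)" for A
    using C(1) by (simp add: of_bool_def sum.If_cases Int_def)
  let ?e = "(\<Sum>q<r. ind {s q..<s q + m}) + z"
  assume "?e \<in> path_exps n m t"
  then obtain s' where "?e \<in> mons n" and s': "\<And>p. p < t \<Longrightarrow> 1 \<le> s' p \<and> s' p + m \<le> n + 1"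
    "\<And>i. (\<Sum>p<t. of_bool (i \<in> {s' p..<s' p + m})) \<le> lookup ?e i"
    by (rule path_expsE) (rule that)
  \<comment> \<open>Double counting of the incidences of \<open>C\<close> with the \<open>t\<close>
    windows: each window contributes at least one, while summation by vertices gives at most the
    total exponent on \<open>C\<close>, where \<open>z\<close> vanishes, hence at most
    \<open>r\<close>.\<close>
  have "t = (\<Sum>p<t. 1)" by simp
  also have "\<dots> \<le> (\<Sum>p<t. card (C \<inter> {s' p..<s' p + m}))"
  proof (rule sum_mono)
    fix p assume "p \<in> {..<t}"
    then have "C \<inter> {s' p..<s' p + m} \<noteq> {}" using s'(1) C(2) by simp
    then show "1 \<le> card (C \<inter> {s' p..<s' p + m})"
      using C(1) by (simp add: Suc_le_eq card_gt_0_iff)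
  qed
  also have "\<dots> = (\<Sum>i\<in>C. \<Sum>p<t. of_bool (i \<in> {s' p..<s' p + m}))"
    unfolding weight[symmetric] by (rule sum.swap)
  also have "\<dots> \<le> (\<Sum>i\<in>C. lookup ?e i)"
    by (intro sum_mono s'(2))
  also have "\<dots> = (\<Sum>i\<in>C. \<Sum>q<r. of_bool (i \<in> {s q..<s q + m}))"
    by (intro sum.cong) (simp_all add: lookup_add lookup_sum lookup_ind z)
  also have "\<dots> = (\<Sum>q<r. card (C \<inter> {s q..<s q + m}))"
    unfolding weight[symmetric] by (rule sum.swap)
  also have "\<dots> \<le> (\<Sum>q<r. 1)" by (intro sum_mono r(2)) simp
  also have "\<dots> < t" using r(1) by simp
  finally show False by simp
qed

section \<open>Windows and residues modulo \<open>m\<close>\<close>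

lemma sum_ind_mons:
  fixes r :: nat
  assumes "\<And>q. q < r \<Longrightarrow> 1 \<le> s q \<and> s q + m \<le> n + (1::nat)"
  shows "(\<Sum>q<r. ind {s q..<s q + m}) \<in> mons n"
  using assms
proof (induction r)
  case 0
  then show ?case by (simp add: zero_mons)
next
  case (Suc r)
  then have "1 \<le> s r \<and> s r + m \<le> n + 1" by simp
  then have "{s r..<s r + m} \<subseteq> {1..n}" by auto
  then show ?case using Suc by (simp add: add_mons ind_mons)
qed

lemma window_meets_residue_class:
  assumes "1 \<le> (m::nat)"
  shows "\<exists>i\<in>{j..<j + m}. i mod m = c mod m"
proof -
  \<comment> \<open>The offset is the residue of \<open>c - j\<close>, with
    \<open>(m - 1) * j\<close> standing for \<open>-j\<close> to stay in the naturals.\<close>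
  let ?i = "j + (c + (m - 1) * j) mod m"
  have "?i mod m = (j + (c + (m - 1) * j)) mod m" by (simp add: mod_add_right_eq)
  also have "j + (c + (m - 1) * j) = c + m * j"
    using assms by (cases m) simp_all
  finally show ?thesis using assms by (intro bexI[of _ ?i]) auto
qed

lemma same_residue_in_window:
  assumes "i \<in> {j..<j + m}" "i' \<in> {j..<j + m}" "i mod m = i' mod (m::nat)"
  shows "i = i'"
proof -
  have "i = i'" if "i \<le> i'" "i \<in> {j..<j + m}" "i' \<in> {j..<j + m}" "i mod m = i' mod m" for i i'
  proof -
    have "m dvd i' - i" using that by (metis mod_eq_dvd_iff_nat)
    moreover have "i' - i < m" using that by auto
    ultimately have "i' - i = 0" using dvd_imp_le by fastforce
    then show ?thesis using that by simp
  qed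
  then show ?thesis using assms by (metis linear)
qed

lemma congruent_less_imp_add_le:
  assumes "i < j" "i mod m = j mod (m::nat)"
  shows "i + m \<le> j"
proof -
  have "m dvd j - i" using assms by (metis less_imp_le mod_eq_dvd_iff_nat)
  then have "m \<le> j - i" using assms by (intro dvd_imp_le) auto
  then show ?thesis using assms by simp
qed

text \<open>
  The classes are the residue classes modulo \<open>m\<close>. Replacing the window at \<open>p\<close> by the one at
  \<open>p + 1\<close> exchanges the vertex \<open>p\<close> for \<open>p + m\<close> in its class. Doing this whenever \<open>p + m\<close> does
  not exceed the vertex of the transversal in the class of \<open>p\<close> moves that class of the window
  at \<open>1\<close> to the transversal.
\<close>

lemma residue_classes_bound:
  assumes m: "1 \<le> m" and t0: "1 \<le> t0" "t0 \<le> t" "t0 + m \<le> n"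
  shows "2 * sdepth_ideal n (supported (path_exps n m t) :: 'k::field mpoly set) + t0 \<le> 2 * n"
proof -
  \<comment> \<open>There are \<open>t0 + m\<close> vertices in \<open>m\<close> classes, so
    \<open>m\<close> cancels from the counting bound.\<close>
  define V where "V = {1..t0 + m}"
  \<comment> \<open>The \<open>t - 1\<close> windows of \<open>w\<close> start once at each of
    \<open>2, ..., t0\<close> and \<open>t - t0\<close> times at 1. One more window at 1 would
    complete the list \<open>1, ..., t0\<close>; the transversal replaces it.\<close>
  define s where "s q = (if q + 1 < t0 then q + 2 else (1::nat))" for q
  define w where "w = (\<Sum>q<t - 1. ind {s q..<s q + m})"
  have s: "1 \<le> s q \<and> s q + m \<le> n + 1" for q using t0 by (auto simp: s_def)
  have image: "(\<lambda>i. i mod m) ` V = {..<m}"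
  proof
    show "(\<lambda>i. i mod m) ` V \<subseteq> {..<m}" using m by auto
    show "{..<m} \<subseteq> (\<lambda>i. i mod m) ` V"
    proof
      fix c assume "c \<in> {..<m}"
      moreover obtain i where "i \<in> {1..<1 + m}" "i mod m = c mod m"
        using window_meets_residue_class[OF m] by blast
      ultimately show "c \<in> (\<lambda>i. i mod m) ` V" by (intro image_eqI[of _ _ i]) (auto simp: V_def)
    qed
  qed
  have "2 * sdepth_ideal n (supported (path_exps n m t) :: 'k mpoly set) + card V
      \<le> 2 * n + card ((\<lambda>i. i mod m) ` V)"
  proof (rule sdepth_ideal_bound[OF upset_path_exps path_exps_truncate, where w = w])
    show "V \<subseteq> {1..n}" using t0 by (auto simp: V_def)
    show "w + ind T \<in> path_exps n m t"
      if T: "T \<subseteq> V" "bij_betw (\<lambda>i. i mod m) T ((\<lambda>i. i mod m) ` V)" for T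
    proof -
      define \<tau> where "\<tau> i = the_inv_into T (\<lambda>i. i mod m) (i mod m)" for i
      have inj: "inj_on (\<lambda>i. i mod m) T" and im: "(\<lambda>i. i mod m) ` T = {..<m}"
        using T(2) unfolding image by (auto simp: bij_betw_def)
      have \<tau>: "\<tau> i \<in> T" "\<tau> i mod m = i mod m" for i
      proof -
        have "i mod m \<in> (\<lambda>i. i mod m) ` T" unfolding im using m by simp
        then show "\<tau> i \<in> T" "\<tau> i mod m = i mod m"
          using the_inv_into_into[OF inj, of "i mod m" T] f_the_inv_into_f[OF inj, of "i mod m"]
          by (auto simp: \<tau>_def)
      qed
      have \<tau>_cong: "\<tau> i = \<tau> (i + m)" for i by (simp add: \<tau>_def)
      have finT: "finite T" using T(1) finite_subset by (auto simp: V_def)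
      have \<tau>_le: "1 \<le> \<tau> i" "\<tau> i \<le> t0 + m" for i using \<tau>(1)[of i] T(1) by (auto simp: V_def)
      \<comment> \<open>\<open>b p\<close> records whether the window at \<open>p\<close> is moved
        to \<open>p + 1\<close>. Index \<open>p\<close> of \<open>s'\<close> belongs to the window
        at \<open>p + 1\<close>, and the windows from index \<open>t0\<close> on stay at 1.\<close>
      define b where "b p = (if p + m \<le> \<tau> p then 1 else 0::nat)" for p
      define s' where "s' p = (if p < t0 then p + 1 + b (p + 1) else 1)" for p
      let ?W = "\<lambda>j i. of_bool (i \<in> {j..<j + m}) :: nat"
      show ?thesis
      proof (rule path_expsI[where s = s'])
        show "w + ind T \<in> mons n"
          unfolding w_def using s t0 T(1)
          by (intro add_mons sum_ind_mons ind_mons) (auto simp: V_def)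
        show "1 \<le> s' p \<and> s' p + m \<le> n + 1" for p using t0 by (auto simp: s'_def b_def)
        show "(\<Sum>p<t. of_bool (i \<in> {s' p..<s' p + m})) \<le> lookup (w + ind T) i" for i
        proof -
          have split: "(\<Sum>q<t. f q) = (\<Sum>q<t0. f q) + (\<Sum>q\<in>{t0..<t}. f q)" for f :: "nat \<Rightarrow> nat"
            using t0 by (simp add: lessThan_atLeast0 sum.atLeastLessThan_concat)
          have "(\<Sum>q<t - 1. ?W (s q) i) + ?W 1 i = (\<Sum>q<t. ?W (if q < t0 then q + 1 else 1) i)"
          proof -
            have "(\<Sum>q<t. ?W (if q < t0 then q + 1 else 1) i) =
                (\<Sum>q<Suc (t - 1). ?W (if q < t0 then q + 1 else 1) i)"
              using t0 by simp
            also have "\<dots> = ?W 1 i + (\<Sum>q<t - 1. ?W (s q) i)"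
              unfolding sum.lessThan_Suc_shift using t0
              by (intro arg_cong2[where f = "(+)"] sum.cong) (auto simp: s_def)
            finally show ?thesis by simp
          qed
          then have w: "lookup w i + ?W 1 i = (\<Sum>q<t0. ?W (q + 1) i) + (\<Sum>q\<in>{t0..<t}. ?W 1 i)"
            by (simp add: w_def lookup_sum lookup_ind split)
          \<comment> \<open>Moving the window at \<open>q + 1\<close> loses the vertex
            \<open>q + 1\<close> and gains \<open>q + 1 + m\<close>; losses and gains stand on
            opposite sides to avoid subtraction.\<close>
          have "(\<Sum>q<t0. ?W (s' q) i) + (\<Sum>q<t0. of_bool (i = q + 1) * b (q + 1)) =
              (\<Sum>q<t0. ?W (q + 1) i) + (\<Sum>q<t0. of_bool (i = q + 1 + m) * b (q + 1))"
            unfolding sum.distrib[symmetric] using m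
            by (intro sum.cong) (auto simp: s'_def b_def)
          moreover have "(\<Sum>q<t0. of_bool (i = q + 1) * b (q + 1)) = of_bool (1 \<le> i \<and> i \<le> t0 \<and> i + m \<le> \<tau> i)"
          proof (cases "1 \<le> i \<and> i \<le> t0")
            case True
            have "(\<Sum>q<t0. of_bool (i = q + 1) * b (q + 1)) = (\<Sum>q\<in>{i - 1}. of_bool (i = q + 1) * b (q + 1))"
              using True by (intro sum.mono_neutral_right) auto
            then show ?thesis using True by (simp add: b_def)
          qed (auto intro!: sum.neutral)
          moreover have "(\<Sum>q<t0. of_bool (i = q + 1 + m) * b (q + 1)) = of_bool (m < i \<and> i \<le> t0 + m \<and> i \<le> \<tau> i)"
          proof (cases "m < i \<and> i \<le> t0 + m")
            case True
            have "(\<Sum>q<t0. of_bool (i = q + 1 + m) * b (q + 1)) =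
                (\<Sum>q\<in>{i - 1 - m}. of_bool (i = q + 1 + m) * b (q + 1))"
              using True by (intro sum.mono_neutral_right) auto
            moreover have "i - 1 - m + 1 = i - m" using True by arith
            ultimately show ?thesis using True \<tau>_cong[of "i - m"] by (simp add: b_def del: Suc_eq_plus1)
          qed (auto intro!: sum.neutral)
          moreover have "of_bool (m < i \<and> i \<le> t0 + m \<and> i \<le> \<tau> i) + ?W 1 i
              \<le> of_bool (1 \<le> i \<and> i \<le> t0 \<and> i + m \<le> \<tau> i) + (of_bool (i \<in> T) :: nat)"
          proof -
            \<comment> \<open>\<open>\<tau> i\<close> is the vertex of \<open>T\<close> in the class
              of \<open>i\<close>, so distinct \<open>i\<close> and \<open>\<tau> i\<close> are at
              least \<open>m\<close> apart. Below \<open>\<tau> i\<close> the move frees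
              \<open>i\<close>, at \<open>\<tau> i\<close> the set \<open>T\<close> supplies it, and
              above \<open>\<tau> i\<close> the left side is 0.\<close>
            consider "i = 0" | "1 \<le> i" "i < \<tau> i" | "i = \<tau> i" | "\<tau> i < i" by linarith
            then show ?thesis
            proof cases
              case 2
              then have "i + m \<le> \<tau> i" using congruent_less_imp_add_le \<tau>(2) by metis
              then show ?thesis using \<tau>_le[of i] 2 by (simp add: of_bool_def)
            next
              case 3
              then have "i \<in> T" using \<tau>(1) by metis
              then show ?thesis by (auto simp: of_bool_def)
            next
              case 4
              then have "\<tau> i + m \<le> i" using congruent_less_imp_add_le \<tau>(2) by metis
              then show ?thesis using \<tau>_le[of i] by (simp add: of_bool_def)
            qed simp
          qed
          moreover have "(\<Sum>q\<in>{t0..<t}. ?W (s' q) i) = (\<Sum>q\<in>{t0..<t}. ?W 1 i)"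
            by (intro sum.cong) (auto simp: s'_def)
          ultimately have "(\<Sum>q<t. ?W (s' q) i) \<le> lookup w i + of_bool (i \<in> T)"
            using w unfolding split by linarith
          then show ?thesis using finT by (simp add: lookup_add lookup_ind)
        qed
      qed
    qed
    show "w + ind E \<notin> path_exps n m t"
      if E: "E \<subseteq> V" "(\<lambda>i. i mod m) ` E \<noteq> (\<lambda>i. i mod m) ` V" for E
    proof -
      obtain j where j: "j mod m \<notin> (\<lambda>i. i mod m) ` E"
        using E by blast
      have finE: "finite E" using E(1) finite_subset by (auto simp: V_def)
      \<comment> \<open>The missed class is a vertex cover that each window meets exactly once.
        \<open>E\<close> avoids it, so only the \<open>t - 1\<close> windows of \<open>w\<close>
        count there.\<close>
      let ?C = "{i \<in> {1..n}. i mod m = j mod m}"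
      show ?thesis
        unfolding w_def
      proof (rule not_in_path_exps[where C = ?C])
        fix l assume "1 \<le> l" "l + m \<le> n + 1"
        moreover obtain i where "i \<in> {l..<l + m}" "i mod m = j mod m"
          using window_meets_residue_class[OF m] by blast
        ultimately have "i \<in> ?C \<inter> {l..<l + m}" by simp
        then show "?C \<inter> {l..<l + m} \<noteq> {}" by blast
      next
        fix q
        show "card (?C \<inter> {s q..<s q + m}) \<le> 1"
          using same_residue_in_window[of _ "s q" m]
          by (subst card_le_Suc0_iff_eq[unfolded One_nat_def[symmetric]]) auto
      next
        fix i assume "i \<in> ?C"
        then have "i mod m = j mod m" by simp
        then have "i \<notin> E" using j by (metis imageI)
        then show "lookup (ind E) i = 0" using finE by (simp add: lookup_ind)
      qed (use t0 in auto)
    qed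
  qed
  then show ?thesis unfolding image by (simp add: V_def)
qed

text \<open>
  The vertices congruent to \<open>0\<close> or \<open>1\<close> modulo \<open>m + 1\<close> form a vertex cover \<open>C\<close>. Each vertex
  of \<open>C\<close> below \<open>k (m + 1)\<close> has a window that meets \<open>C\<close> only there, so \<open>2k - 1\<close> variables
  multiply the monomial of exponent \<open>w\<close> into the power, although \<open>w\<close> has weight \<open>t - 1\<close> on \<open>C\<close>.
\<close>

lemma vertex_cover_bound:
  fixes n m t :: nat
  defines "k \<equiv> (n + 1) div (m + 1)"
  assumes m: "1 \<le> m" "m \<le> n" and t: "1 \<le> t"
  shows "sdepth_ideal n (supported (path_exps n m t) :: 'k::field mpoly set) + k \<le> n + 1"
proof -
  let ?M = "m + 1"
  define C where "C = {i \<in> {1..n}. i mod ?M \<le> 1}"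
  define V where "V = {i \<in> C. i < k * ?M}"
  define F where "F = {1..n} - C"
  \<comment> \<open>The factor \<open>ind F\<close> provides every vertex outside \<open>C\<close>,
    so a window meeting \<open>C\<close> only in \<open>c\<close> merely needs the variable with
    index \<open>c\<close>.\<close>
  define w where "w = (\<Sum>q<t - 1. ind {1..<1 + m}) + ind F"
  have k1: "1 \<le> k" unfolding k_def using m div_le_mono[of ?M "n + 1" ?M] by simp
  have kM: "k * ?M \<le> n + 1" unfolding k_def by (rule div_times_less_eq_dividend)
  have finF: "finite F" and finV: "finite V" by (simp_all add: F_def V_def C_def)
  have "1 \<in> V" using m k1 mult_le_mono1[OF k1, of ?M] by (auto simp: V_def C_def)
  \<comment> \<open>With a single fibre the transversals are the singletons of \<open>V\<close>, and
    only the empty set misses the fibre.\<close>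
  then have image_V: "(\<lambda>_. ()) ` V = {()}" by auto
  have card_V: "2 * k - 1 \<le> card V"
  proof -
    \<comment> \<open>\<open>?A\<close> collects the residue 1 and \<open>?B\<close> the residue 0.
      The latter starts at \<open>q = 1\<close> because 0 is not a vertex, which costs one
      element.\<close>
    let ?A = "(\<lambda>q. q * ?M + 1) ` {..<k}" and ?B = "(\<lambda>q. q * ?M) ` {1..<k}"
    have below: "q * ?M + ?M \<le> k * ?M" if "q < k" for q
      using mult_le_mono1[of "Suc q" k ?M] that by simp
    have mod1: "(q * ?M + 1) mod ?M = 1" for q
      unfolding mod_mult_self3 using m by simp
    have "?A \<union> ?B \<subseteq> V"
    proof
      fix i assume "i \<in> ?A \<union> ?B"
      then consider q where "q < k" "i = q * ?M + 1" | q where "1 \<le> q" "q < k" "i = q * ?M" by auto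
      then show "i \<in> V"
      proof cases
        case 1
        then have "i mod ?M = 1" by (simp only: mod1)
        then show ?thesis using 1 below[of q] kM m by (simp add: V_def C_def)
      next
        case 2
        then have "i mod ?M = 0" by (simp only: mod_mult_self2_is_0)
        then show ?thesis using 2 below[of q] kM m by (simp add: V_def C_def)
      qed
    qed
    then have "card (?A \<union> ?B) \<le> card V" using finV by (rule card_mono[rotated])
    moreover have "?A \<inter> ?B = {}"
    proof -
      have "q * ?M + 1 \<noteq> q' * ?M" for q q'
        using mod1[of q] mod_mult_self2_is_0[of q' ?M] by (metis zero_neq_one)
      then show ?thesis by auto
    qed
    moreover have "card ?A = k" "card ?B = k - 1"
      by (simp_all add: card_image inj_on_def del: mult_Suc_right)
    ultimately show ?thesis by (simp add: card_Un_disjoint)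
  qed
  have mod_block: "(x + q * ?M) mod ?M = x" if "x < ?M" for x q
    using that by (simp only: mod_mult_self1 mod_less)
  have own_window: "\<exists>l. 1 \<le> l \<and> l + m \<le> n + 1 \<and> c \<in> {l..<l + m} \<and> {l..<l + m} \<inter> C \<subseteq> {c}"
    if c: "c \<in> V" for c
  proof -
    define q where "q = c div ?M"
    have c_eq: "c = q * ?M + c mod ?M" unfolding q_def by (rule div_mult_mod_eq[symmetric])
    have "1 \<le> c" "c < k * ?M" "c mod ?M = 0 \<or> c mod ?M = 1" using c by (auto simp: V_def C_def)
    from this(3) show ?thesis
    proof
      assume "c mod ?M = 1"
      with c_eq have c_eq: "c = q * ?M + 1" by simp
      then have "q < k" using \<open>c < k * ?M\<close> mult_le_mono1[of k q ?M] by linarith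
      then have "(q + 1) * ?M \<le> k * ?M" by (intro mult_le_mono1) simp
      then have "c + m \<le> n + 1" using kM c_eq by simp
      \<comment> \<open>The window starting at \<open>c\<close> has residues
        \<open>1, ..., m\<close>, of which only the first belongs to \<open>C\<close>.\<close>
      moreover have "{c..<c + m} \<inter> C \<subseteq> {c}"
      proof
        fix i assume i: "i \<in> {c..<c + m} \<inter> C"
        then obtain x where x: "i = c + x" "x < m" using that[of "i - c"] by auto
        then have "i = (1 + x) + q * ?M" using c_eq by simp
        moreover have "1 + x < ?M" using x by simp
        ultimately have "i mod ?M = 1 + x" by (simp only: mod_block)
        then show "i \<in> {c}" using i x by (simp add: C_def)
      qed
      ultimately show ?thesis using \<open>1 \<le> c\<close> m by (intro exI[of _ c]) simp
    next
      assume "c mod ?M = 0"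
      with c_eq have c_eq: "c = q * ?M" by simp
      then obtain p where p: "q = Suc p" using \<open>1 \<le> c\<close> by (cases q) auto
      \<comment> \<open>The window ending at \<open>c\<close>: its residues are
        \<open>2, ..., m\<close> and finally 0.\<close>
      let ?l = "p * ?M + 2"
      have cl: "c + 1 = ?l + m" using c_eq p by simp
      moreover have "{?l..<?l + m} \<inter> C \<subseteq> {c}"
      proof
        fix i assume i: "i \<in> {?l..<?l + m} \<inter> C"
        then obtain x where x: "i = ?l + x" "x < m" using that[of "i - ?l"] by auto
        show "i \<in> {c}"
        proof (cases "x + 1 = m")
          case True
          then show ?thesis using cl x by simp
        next
          case False
          then have "i = (2 + x) + p * ?M" "2 + x < ?M" using x by simp_all
          then have "i mod ?M = 2 + x" by (simp only: mod_block)
          then show ?thesis using i by (simp add: C_def)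
        qed
      qed
      ultimately show ?thesis using \<open>c < k * ?M\<close> kM m by (intro exI[of _ ?l]) simp
    qed
  qed
  have cover: "C \<inter> {j..<j + m} \<noteq> {}" if j: "1 \<le> j" "j + m \<le> n + 1" for j
  proof (cases "j mod ?M \<le> 1")
    case True
    then have "j \<in> C \<inter> {j..<j + m}" using j m by (simp add: C_def)
    then show ?thesis by blast
  next
    case False
    \<comment> \<open>A start with residue at least 2 is fewer than \<open>m\<close> steps before
      the next multiple of \<open>m + 1\<close>, which lies in \<open>C\<close>.\<close>
    define d where "d = ?M - j mod ?M"
    have "j mod ?M < ?M" by simp
    then have d: "d < m" "j + d = Suc (j div ?M) * ?M"
      unfolding mult_Suc d_def using False div_mult_mod_eq[of j ?M] by linarith+
    then have "(j + d) mod ?M = 0" by (simp only: mod_mult_self2_is_0)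
    with d(1) have "j + d \<in> C \<inter> {j..<j + m}" using j by (simp add: C_def)
    then show ?thesis by blast
  qed
  have "2 * sdepth_ideal n (supported (path_exps n m t) :: 'k mpoly set) + card V
      \<le> 2 * n + card ((\<lambda>_. ()) ` V)"
  proof (rule sdepth_ideal_bound[OF upset_path_exps path_exps_truncate, where w = w])
    show "V \<subseteq> {1..n}" by (auto simp: V_def C_def)
    show "w + ind T \<in> path_exps n m t"
      if T: "T \<subseteq> V" "bij_betw (\<lambda>_. ()) T ((\<lambda>_. ()) ` V)" for T
    proof -
      have "T \<noteq> {}" using T(2) \<open>1 \<in> V\<close> by (auto simp: bij_betw_def)
      then obtain c where c: "c \<in> T" "c \<in> V" using T(1) by blast
      have finT: "finite T" using T(1) finV finite_subset by blast
      obtain l where l: "1 \<le> l" "l + m \<le> n + 1" "c \<in> {l..<l + m}" "{l..<l + m} \<inter> C \<subseteq> {c}"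
        using own_window[OF c(2)] by blast
      show ?thesis
      proof (rule path_expsI[where s = "\<lambda>p. if p < t - 1 then 1 else l"])
        have "{1..<1 + m} \<subseteq> {1..n}" using m by auto
        moreover have "T \<subseteq> {1..n}" "F \<subseteq> {1..n}" using T(1) by (auto simp: V_def C_def F_def)
        ultimately show "w + ind T \<in> mons n"
          unfolding w_def using m by (intro add_mons ind_mons sum_ind_mons) auto
        show "1 \<le> (if p < t - 1 then 1 else l) \<and> (if p < t - 1 then 1 else l) + m \<le> n + 1" for p
          using l m by simp
        fix i
        have "(\<Sum>p<t. of_bool (i \<in> {if p < t - 1 then 1 else l..<(if p < t - 1 then 1 else l) + m})) =
            (\<Sum>p<Suc (t - 1). of_bool (i \<in> {if p < t - 1 then 1 else l..<(if p < t - 1 then 1 else l) + m}) :: nat)"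
          using t by simp
        also have "\<dots> = (\<Sum>p<t - 1. of_bool (i \<in> {1..<1 + m})) + of_bool (i \<in> {l..<l + m})"
          by simp
        also have "\<dots> \<le> (\<Sum>p<t - 1. of_bool (i \<in> {1..<1 + m})) + (of_bool (i \<in> F) + of_bool (i \<in> T))"
          using l c(1) by (auto simp: F_def)
        also have "\<dots> = lookup (w + ind T) i"
          using finT finF by (simp add: w_def lookup_add lookup_sum lookup_ind del: sum_constant)
        finally show "(\<Sum>p<t. of_bool (i \<in> {if p < t - 1 then 1 else l..<(if p < t - 1 then 1 else l) + m}))
            \<le> lookup (w + ind T) i" .
      qed
    qed
    show "w + ind E \<notin> path_exps n m t" if E: "E \<subseteq> V" "(\<lambda>_. ()) ` E \<noteq> (\<lambda>_. ()) ` V" for E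
    proof -
      have "E = {}"
      proof (rule ccontr)
        assume "E \<noteq> {}"
        then have "(\<lambda>_. ()) ` E = {()}" by auto
        with E(2) image_V show False by simp
      qed
      then have "w + ind E = w" by (simp add: ind_def)
      moreover have "w \<notin> path_exps n m t"
        unfolding w_def
      proof (rule not_in_path_exps[where C = C and s = "\<lambda>_. 1"])
        \<comment> \<open>All \<open>t - 1\<close> windows of \<open>w\<close> start at 1 and meet
          \<open>C\<close> only there, so \<open>w\<close> has weight at most \<open>t - 1\<close>
          on \<open>C\<close>.\<close>
        have "C \<inter> {1..<1 + m} \<subseteq> {1}" by (auto simp: C_def)
        then show "card (C \<inter> {1..<1 + m}) \<le> 1"
          using card_mono[of "{1}" "C \<inter> {1..<1 + m}"] by simp
        show "lookup (ind F) i = 0" if "i \<in> C" for i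
          using that finF by (simp add: lookup_ind F_def)
        show "C \<inter> {j..<j + m} \<noteq> {}" if "1 \<le> j" "j + m \<le> n + 1" for j
          using that by (rule cover)
        show "finite C" by (simp add: C_def)
        show "t - 1 < t" using t by simp
      qed
      ultimately show ?thesis by simp
    qed
  qed
  then show ?thesis using card_V k1 unfolding image_V by simp
qed

text \<open>With \<open>V\<close> empty the counting bound only asks for one exponent in the power.
  This covers the case \<open>t0 = 0\<close> of the first bound.\<close>

lemma sdepth_path_power_le:
  assumes "1 \<le> m" "m \<le> n"
  shows "sdepth_ideal n (supported (path_exps n m t) :: 'k::field mpoly set) \<le> n"
proof -
  have w: "(\<Sum>q<t. ind {1..<1 + m}) \<in> path_exps n m t"
    using assms by (intro path_expsI[where s = "\<lambda>_. 1"] sum_ind_mons)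
      (auto simp: lookup_sum lookup_ind simp del: sum_constant)
  have "2 * sdepth_ideal n (supported (path_exps n m t) :: 'k mpoly set) + card ({} :: nat set)
      \<le> 2 * n + card ((\<lambda>i. i) ` ({} :: nat set))"
  proof (rule sdepth_ideal_bound[OF upset_path_exps path_exps_truncate])
    show "(\<Sum>q<t. ind {1..<1 + m}) + ind T \<in> path_exps n m t" if "T \<subseteq> {}" for T
      using that w by (simp add: ind_def)
    show "({} :: nat set) \<subseteq> {1..n}" by simp
    show "(\<Sum>q<t. ind {1..<1 + m}) + ind E \<notin> path_exps n m t"
      if "E \<subseteq> {}" "(\<lambda>i. i) ` E \<noteq> (\<lambda>i. i) ` {}" for E
      using that by simp
  qed
  then show ?thesis by simp
qed

theorem theorem4p3:
  fixes n m t t0 :: nat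
  assumes "1 \<le> m" and "m \<le> n" and "1 \<le> t"
    and "t0 = min t (n - m)"
  shows "int (sdepth_ideal n (ideal_power n (path_ideal n m :: 'k::field mpoly set) t))
    \<le> min (int n - \<lceil>real t0 / 2\<rceil>)
          (int n - \<lfloor>(real n - real t0 + 1) / (real m + 1)\<rfloor> + 1)"
proof -
  define d where "d = sdepth_ideal n (supported (path_exps n m t) :: 'k mpoly set)"
  have "2 * d + t0 \<le> 2 * n"
  proof (cases "t0 = 0")
    case True
    then show ?thesis using sdepth_path_power_le assms(1,2) by (simp add: d_def)
  next
    case False
    then show ?thesis
      unfolding d_def using assms by (intro residue_classes_bound) auto
  qed
  then have "real t0 / 2 \<le> of_int (int n - int d)" by simp
  then have "\<lceil>real t0 / 2\<rceil> \<le> int n - int d" by (rule ceiling_le)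
  \<comment> \<open>As \<open>t0\<close> is nonnegative, the numerator is at most
    \<open>n + 1\<close>, which leads to the quotient in \<open>vertex_cover_bound\<close>.\<close>
  moreover have "\<lfloor>(real n - real t0 + 1) / (real m + 1)\<rfloor> \<le> \<lfloor>real (n + 1) / real (m + 1)\<rfloor>"
    by (intro floor_mono) (simp add: field_simps)
  then have "\<lfloor>(real n - real t0 + 1) / (real m + 1)\<rfloor> \<le> int ((n + 1) div (m + 1))"
    unfolding floor_divide_of_nat_eq .
  moreover have "d + (n + 1) div (m + 1) \<le> n + 1"
    unfolding d_def by (rule vertex_cover_bound[OF assms(1-3)])
  ultimately show ?thesis
    unfolding ideal_power_supported d_def[symmetric] by linarith
qed

end
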